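(* Fix an integer $m\ge1$, $a\in\left(0,\frac{m}{m+2}\right)$, and let $j_n=\lfloor n^a\rfloor$. Given $\sigma\in(0,1)$, there exists a unique root $z(\sigma)\in(1,\infty)$ of the equation $$(1-\sigma)^{-1/2}-1=\varphi(z),\qquad \varphi(z):=(z\log z+1-z)^{-1},$$ and $z(\sigma)\sim 2\bigl(\sigma\log(1/\sigma)\bigr)^{-1}$ as $\sigma\to0$. If $z>z(\sigma)$, then $$\lim_{n\to\infty}\mathbb P\Bigl(D(j)\le z\bigl((n/j)^{1/2}-1\bigr)\log n\ \text{ for all } j\in[j_n,(1-\sigma)n]\Bigr)=1,$$ where $D(j)$ is the degree of vertex $j$ in $G_m^n$.
   Context: Bollobás–Riordan preferential attachment multigraph $G_m^n$. Let $w_1,\dots,w_{mn+1}$ be independent exponential random variables with mean $1$, $W_k=\sum_{i=1}^k w_i$, $W_0=0$. Put $R_k=W_k/W_{mn+1}$ for $k=1,\dots,mn$, $R_0=0$. Conditionally on $\mathbf W=\{W_k\}$, let $\ell_1,\dots,\ell_{mn}$ be independent, $\ell_k$ having density $\frac{1}{2\sqrt{R_k x}}$ on $(0,R_k]$. The vertex set of $G_m^n$ is $[n]$; vertex $j$ is identified with the interval $(R_{m(j-1)},R_{mj}]$. For each $k\in[mn]$ there is one edge joining the vertex containing $R_k$ with the vertex containing $\ell_k$ (a loop if these coincide). A loop contributes $2$ to the degree of its vertex. *)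

theory Defs
  imports
    "HOL-Probability.Probability"
    "HOL-Library.Multiset"
    "HOL-Library.Landau_Symbols"
begin

text \<open>
  A sample point is a pair \<open>(w, l)\<close> with \<open>w\<close> indexed by \<open>{1..m*n+1}\<close> and \<open>l\<close> by \<open>{1..m*n}\<close>.
\<close>

definition pa_W :: "(nat \<Rightarrow> real) \<Rightarrow> nat \<Rightarrow> real" where
  "pa_W w k = (\<Sum>i=1..k. w i)"

definition pa_R :: "nat \<Rightarrow> nat \<Rightarrow> (nat \<Rightarrow> real) \<Rightarrow> nat \<Rightarrow> real" where
  "pa_R m n w k = pa_W w k / pa_W w (m * n + 1)"

definition pa_end_density :: "real \<Rightarrow> real \<Rightarrow> real" where
  "pa_end_density r x = (if 0 < x \<and> x \<le> r then 1 / (2 * sqrt (r * x)) else 0)"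

abbreviation pa_w_space :: "nat \<Rightarrow> nat \<Rightarrow> (nat \<Rightarrow> real) measure" where
  "pa_w_space m n \<equiv> \<Pi>\<^sub>M i\<in>{1..m * n + 1}. borel"

abbreviation pa_l_space :: "nat \<Rightarrow> nat \<Rightarrow> (nat \<Rightarrow> real) measure" where
  "pa_l_space m n \<equiv> \<Pi>\<^sub>M k\<in>{1..m * n}. borel"

definition pa_w_law :: "nat \<Rightarrow> nat \<Rightarrow> (nat \<Rightarrow> real) measure" where
  "pa_w_law m n = (\<Pi>\<^sub>M i\<in>{1..m * n + 1}. density lborel (exponential_density 1))"

definition pa_l_law :: "nat \<Rightarrow> nat \<Rightarrow> (nat \<Rightarrow> real) \<Rightarrow> (nat \<Rightarrow> real) measure" where
  "pa_l_law m n w = (\<Pi>\<^sub>M k\<in>{1..m * n}. density lborel (pa_end_density (pa_R m n w k)))"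

text \<open>
  Conditioning on \<open>W\<close> and conditioning on \<open>w\<close> agree, since each sequence determines the other.
  On the null set where some \<open>w i\<close> fails to be positive, \<open>pa_l_law\<close> may be a strict
  sub-probability measure; \<open>prob_space_pa_space\<close> below shows that this does no harm.
\<close>

definition pa_space :: "nat \<Rightarrow> nat \<Rightarrow> ((nat \<Rightarrow> real) \<times> (nat \<Rightarrow> real)) measure" where
  "pa_space m n =
     do {
       w \<leftarrow> pa_w_law m n;
       l \<leftarrow> pa_l_law m n w;
       return (pa_w_space m n \<Otimes>\<^sub>M pa_l_space m n) (w, l)
     }"

definition pa_interval :: "nat \<Rightarrow> nat \<Rightarrow> (nat \<Rightarrow> real) \<Rightarrow> nat \<Rightarrow> real set" where
  "pa_interval m n w j = {pa_R m n w (m * (j - 1)) <.. pa_R m n w (m * j)}"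

definition pa_vertex :: "nat \<Rightarrow> nat \<Rightarrow> (nat \<Rightarrow> real) \<Rightarrow> real \<Rightarrow> nat" where
  "pa_vertex m n w x = (THE j. j \<in> {1..n} \<and> x \<in> pa_interval m n w j)"

text \<open>
  A multigraph is given by the multiset of its edges, and an edge by the two-element multiset of
  its endpoints, so that a loop at \<open>v\<close> is \<open>{#v, v#}\<close> and contributes 2 to the degree of \<open>v\<close>.
\<close>

definition pa_graph :: "nat \<Rightarrow> nat \<Rightarrow> (nat \<Rightarrow> real) \<Rightarrow> (nat \<Rightarrow> real) \<Rightarrow> nat multiset multiset" where
  "pa_graph m n w l =
     {# {# pa_vertex m n w (pa_R m n w k), pa_vertex m n w (l k) #}. k \<in># mset_set {1..m * n} #}"

definition mg_degree :: "'v multiset multiset \<Rightarrow> 'v \<Rightarrow> nat" where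
  "mg_degree G v = (\<Sum>e\<in>#G. count e v)"

definition pa_phi :: "real \<Rightarrow> real" where
  "pa_phi z = inverse (z * ln z + 1 - z)"

definition pa_is_root :: "real \<Rightarrow> real \<Rightarrow> bool" where
  "pa_is_root \<sigma> z \<longleftrightarrow> z \<in> {1<..} \<and> (1 - \<sigma>) powr (-1/2) - 1 = pa_phi z"

definition pa_root :: "real \<Rightarrow> real" where
  "pa_root \<sigma> = (THE z. pa_is_root \<sigma> z)"


subsection \<open>Well-definedness of the probability space\<close>

lemma pa_end_density_nonneg: "0 \<le> pa_end_density r x"
  by (auto simp: pa_end_density_def)

lemma pa_end_density_measurable [measurable]:
  "case_prod pa_end_density \<in> borel_measurable (borel \<Otimes>\<^sub>M borel)"
  unfolding pa_end_density_def by measurable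

lemma pa_end_density_measurable' [measurable]:
  "pa_end_density r \<in> borel_measurable borel"
  unfolding pa_end_density_def by measurable

lemma pa_end_density_integral:
  assumes "r > 0"
  shows "(\<integral>\<^sup>+x. ennreal (pa_end_density r x) \<partial>lborel) = 1"
proof -
  have "((\<lambda>x. 1 / (2 * sqrt (r * x))) has_integral (sqrt (r / r) - sqrt (0 / r))) {0..r}"
  proof (rule fundamental_theorem_of_calculus_interior)
    show "continuous_on {0..r} (\<lambda>x. sqrt (x / r))"
      using assms by (intro continuous_intros) auto
    show "((\<lambda>x. sqrt (x / r)) has_vector_derivative 1 / (2 * sqrt (r * x))) (at x)"
      if "x \<in> {0<..<r}" for x
    proof -
      have "((\<lambda>x. sqrt (x / r)) has_real_derivative (1 / r) * (inverse (sqrt (x / r)) / 2)) (at x)"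
        using that assms
        by (auto intro!: derivative_eq_intros simp: divide_less_0_iff)
      moreover have "(1 / r) * (inverse (sqrt (x / r)) / 2) = 1 / (2 * sqrt (r * x))"
      proof -
        have "r = sqrt r * sqrt r" using assms by simp
        thus ?thesis using that assms
          by (simp add: real_sqrt_divide real_sqrt_mult field_simps)
      qed
      ultimately show ?thesis
        by (simp add: has_real_derivative_iff_has_vector_derivative)
    qed
  qed (use assms in auto)
  hence "((\<lambda>x. 1 / (2 * sqrt (r * x))) has_integral 1) {0..r}"
    using assms by simp
  hence "(pa_end_density r has_integral 1) {0..r}"
    by (rule has_integral_spike_finite[of "{0}", rotated 2]) (auto simp: pa_end_density_def)
  hence "(pa_end_density r has_integral 1) UNIV"
    by (rule has_integral_on_superset) (auto simp: pa_end_density_def)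
  from nn_integral_has_integral_lborel[OF _ pa_end_density_nonneg this]
  show ?thesis by simp
qed

lemma pa_end_density_zero: "r \<le> 0 \<Longrightarrow> pa_end_density r x = 0"
  by (auto simp: pa_end_density_def)

lemma prob_space_pa_end_density:
  "r > 0 \<Longrightarrow> prob_space (density lborel (pa_end_density r))"
  by (rule prob_spaceI) (simp add: emeasure_density pa_end_density_integral)

lemma emeasure_pa_end_density_le:
  "emeasure (density lborel (pa_end_density r)) A \<le> 1"
proof -
  have "emeasure (density lborel (pa_end_density r)) A
      \<le> emeasure (density lborel (pa_end_density r)) UNIV"
    by (intro emeasure_mono) auto
  also have "\<dots> \<le> 1"
    by (cases "r > 0") (simp_all add: emeasure_density pa_end_density_integral pa_end_density_zero)
  finally show ?thesis .
qed

lemma sets_pa_w_law [measurable_cong, simp]: "sets (pa_w_law m n) = sets (pa_w_space m n)"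
  unfolding pa_w_law_def by (intro sets_PiM_cong) auto

lemma sets_pa_l_law [measurable_cong, simp]: "sets (pa_l_law m n w) = sets (pa_l_space m n)"
  unfolding pa_l_law_def by (intro sets_PiM_cong) auto

lemma pa_W_measurable [measurable]:
  "k \<le> m * n + 1 \<Longrightarrow> (\<lambda>w. pa_W w k) \<in> borel_measurable (pa_w_space m n)"
  unfolding pa_W_def by (intro borel_measurable_sum measurable_component_singleton) auto

lemma pa_R_measurable [measurable]:
  "k \<le> m * n + 1 \<Longrightarrow> (\<lambda>w. pa_R m n w k) \<in> borel_measurable (pa_w_space m n)"
  unfolding pa_R_def by measurable

lemma emeasure_pa_l_law:
  assumes "\<And>k. k \<in> {1..m * n} \<Longrightarrow> A k \<in> sets borel"
  shows "emeasure (pa_l_law m n w) (Pi\<^sub>E {1..m * n} A) =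
           (\<Prod>k\<in>{1..m * n}. emeasure (density lborel (pa_end_density (pa_R m n w k))) (A k))"
proof -
  interpret product_sigma_finite "\<lambda>k. density lborel (pa_end_density (pa_R m n w k))"
  proof (unfold product_sigma_finite_def, intro allI)
    fix k
    have "finite_measure (density lborel (pa_end_density (pa_R m n w k)))"
      by (rule finite_measureI) (use emeasure_pa_end_density_le[of "pa_R m n w k" UNIV] in
        \<open>auto simp: top_unique\<close>)
    thus "sigma_finite_measure (density lborel (pa_end_density (pa_R m n w k)))"
      by (rule finite_measure.sigma_finite_measure)
  qed
  show ?thesis
    unfolding pa_l_law_def using assms by (intro emeasure_PiM) auto
qed

lemma space_pa_l_law: "space (pa_l_law m n w) = Pi\<^sub>E {1..m * n} (\<lambda>_. UNIV)"
  by (simp add: pa_l_law_def space_PiM)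

lemma subprob_space_pa_l_law: "subprob_space (pa_l_law m n w)"
proof (rule subprob_spaceI)
  show "emeasure (pa_l_law m n w) (space (pa_l_law m n w)) \<le> 1"
    unfolding space_pa_l_law
    by (subst emeasure_pa_l_law) (auto intro!: prod_le_1 emeasure_pa_end_density_le)
  show "space (pa_l_law m n w) \<noteq> {}"
    by (simp add: space_pa_l_law PiE_eq_empty_iff)
qed

lemma pa_l_law_measurable [measurable]:
  "pa_l_law m n \<in> measurable (pa_w_space m n) (subprob_algebra (pa_l_space m n))"
proof (rule measurable_subprob_algebra_generated)
  let ?G = "{Pi\<^sub>E {1..m * n} E | E. \<forall>i\<in>{1..m * n}. E i \<in> sets (borel :: real measure)}"
  show "sets (pa_l_space m n) = sigma_sets (Pi\<^sub>E {1..m * n} (\<lambda>_. UNIV)) ?G"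
    unfolding sets_PiM by (subst prod_algebra_eq_finite) (auto simp: Pi_iff)
  show "Int_stable ?G"
    by (rule Int_stable_PiE)
  show "?G \<subseteq> Pow (Pi\<^sub>E {1..m * n} (\<lambda>_. UNIV))"
    by (auto simp: PiE_def)
  have *: "(\<lambda>w. emeasure (pa_l_law m n w) (Pi\<^sub>E {1..m * n} E)) \<in> borel_measurable (pa_w_space m n)"
    if E: "\<forall>i\<in>{1..m * n}. E i \<in> sets (borel :: real measure)" for E
  proof -
    have "(\<lambda>w. emeasure (density lborel (pa_end_density (pa_R m n w k))) (E k))
            \<in> borel_measurable (pa_w_space m n)" if "k \<in> {1..m * n}" for k
    proof -
      have [measurable]: "E k \<in> sets borel" "(\<lambda>w. pa_R m n w k) \<in> borel_measurable (pa_w_space m n)"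
        using E that by (auto intro!: pa_R_measurable simp del: One_nat_def)
      have "(\<lambda>w. \<integral>\<^sup>+x. ennreal (pa_end_density (pa_R m n w k) x) * indicator (E k) x \<partial>lborel)
              \<in> borel_measurable (pa_w_space m n)"
        by measurable
      thus ?thesis by (simp add: emeasure_density)
    qed
    thus ?thesis using E
      by (subst emeasure_pa_l_law) (auto intro!: borel_measurable_prod_ennreal)
  qed
  show "(\<lambda>w. emeasure (pa_l_law m n w) A) \<in> borel_measurable (pa_w_space m n)" if "A \<in> ?G" for A
    using that * by auto
  show "(\<lambda>w. emeasure (pa_l_law m n w) (Pi\<^sub>E {1..m * n} (\<lambda>_. UNIV)))
          \<in> borel_measurable (pa_w_space m n)"
    by (rule *) auto
qed (simp_all add: subprob_space_pa_l_law)

lemma prob_space_pa_w_law: "prob_space (pa_w_law m n)"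
  unfolding pa_w_law_def by (intro prob_space_PiM prob_space_exponential_density) simp

lemma AE_pa_w_law_pos: "AE w in pa_w_law m n. \<forall>i\<in>{1..m * n + 1}. 0 < w i"
proof -
  have "AE x in density lborel (exponential_density 1). (0::real) < x"
  proof -
    have "AE x in lborel. x \<noteq> (0::real)"
      by (rule AE_lborel_singleton)
    thus ?thesis
      by (subst AE_density) (auto simp: erlang_density_def)
  qed
  thus ?thesis
    unfolding pa_w_law_def
    by (intro eventually_ball_finite ballI AE_PiM_component prob_space_exponential_density) auto
qed

lemma pa_kernel_measurable [measurable]:
  "(\<lambda>w. pa_l_law m n w \<bind> (\<lambda>l. return (pa_w_space m n \<Otimes>\<^sub>M pa_l_space m n) (w, l)))
     \<in> measurable (pa_w_space m n) (subprob_algebra (pa_w_space m n \<Otimes>\<^sub>M pa_l_space m n))"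
  by measurable

lemma prob_space_pa_space: "prob_space (pa_space m n)"
proof -
  interpret prob_space "pa_w_law m n" by (rule prob_space_pa_w_law)
  show ?thesis
    unfolding pa_space_def
  proof (rule prob_space_bind)
    show "(\<lambda>w. pa_l_law m n w \<bind> (\<lambda>l. return (pa_w_space m n \<Otimes>\<^sub>M pa_l_space m n) (w, l)))
       \<in> measurable (pa_w_law m n) (subprob_algebra (pa_w_space m n \<Otimes>\<^sub>M pa_l_space m n))"
      by measurable
    show "AE w in pa_w_law m n. prob_space
       (pa_l_law m n w \<bind> (\<lambda>l. return (pa_w_space m n \<Otimes>\<^sub>M pa_l_space m n) (w, l)))"
      using AE_pa_w_law_pos[of m n] AE_space
    proof eventually_elim
      case (elim w)
      have "pa_R m n w k > 0" if "k \<in> {1..m * n}" for k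
        unfolding pa_R_def pa_W_def using that elim
        by (intro divide_pos_pos sum_pos) auto
      hence l: "prob_space (pa_l_law m n w)"
        by (intro prob_spaceI, unfold space_pa_l_law, subst emeasure_pa_l_law)
           (auto intro!: prod.neutral simp: emeasure_density pa_end_density_integral)
      have w: "w \<in> space (pa_w_space m n)"
        using elim(2) sets_eq_imp_space_eq[OF sets_pa_w_law] by metis
      show ?case
      proof (rule prob_space.prob_space_bind[OF l])
        show "AE x in pa_l_law m n w. prob_space (return (pa_w_space m n \<Otimes>\<^sub>M pa_l_space m n) (w, x))"
          using w sets_eq_imp_space_eq[OF sets_pa_l_law, of m n w]
          by (intro AE_I2 prob_space_return) (auto simp: space_pair_measure)
        show "(\<lambda>l. return (pa_w_space m n \<Otimes>\<^sub>M pa_l_space m n) (w, l)) \<in>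
          measurable (pa_l_law m n w) (subprob_algebra (pa_w_space m n \<Otimes>\<^sub>M pa_l_space m n))"
          using w by measurable
      qed
    qed
  qed
qed

lemma sets_pa_space [measurable_cong, simp]:
  "sets (pa_space m n) = sets (pa_w_space m n \<Otimes>\<^sub>M pa_l_space m n)"
proof -
  interpret prob_space "pa_w_law m n" by (rule prob_space_pa_w_law)
  show ?thesis
    unfolding pa_space_def
    by (rule sets_bind[OF sets_kernel[OF pa_kernel_measurable]])
       (use not_empty sets_eq_imp_space_eq[OF sets_pa_w_law] in auto)
qed

lemma pa_vertex_measurable [measurable]:
  assumes [measurable]: "f \<in> borel_measurable (pa_w_space m n \<Otimes>\<^sub>M pa_l_space m n)"
  shows "(\<lambda>\<omega>. pa_vertex m n (fst \<omega>) (f \<omega>))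
           \<in> measurable (pa_w_space m n \<Otimes>\<^sub>M pa_l_space m n) (count_space UNIV)"
proof -
  let ?M = "pa_w_space m n \<Otimes>\<^sub>M pa_l_space m n"
  define S where "S = (\<lambda>\<omega>. {j \<in> {1..n}. f \<omega> \<in> pa_interval m n (fst \<omega>) j})"
  have R: "(\<lambda>\<omega>. pa_R m n (fst \<omega>) k) \<in> borel_measurable ?M" if "k \<le> m * n + 1" for k
    by (rule measurable_compose[OF measurable_fst pa_R_measurable[OF that]])
  have P: "{\<omega> \<in> space ?M. f \<omega> \<in> pa_interval m n (fst \<omega>) j} \<in> sets ?M" if "j \<in> {1..n}" for j
  proof -
    have "m * (j - 1) \<le> m * n + 1" "m * j \<le> m * n + 1"
      using that by (auto intro!: le_SucI mult_le_mono2)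
    note [measurable] = this[THEN R]
    show ?thesis unfolding pa_interval_def greaterThanAtMost_iff by measurable
  qed
  have "S \<in> measurable ?M (count_space (Pow {1..n}))"
  proof (subst measurable_count_space_eq2, simp, intro conjI ballI)
    show "S \<in> space ?M \<rightarrow> Pow {1..n}" by (auto simp: S_def)
    fix T assume T: "T \<in> Pow {1..n}"
    have "S -` {T} \<inter> space ?M = {\<omega> \<in> space ?M. \<forall>j\<in>{1..n}.
            (f \<omega> \<in> pa_interval m n (fst \<omega>) j) = (j \<in> T)}"
      using T unfolding S_def Pow_iff by blast
    also have "\<dots> \<in> sets ?M"
    proof (rule sets.sets_Collect_finite_All)
      fix j assume "j \<in> {1..n}"
      note [measurable] = P[OF this]
      show "{\<omega> \<in> space ?M. (f \<omega> \<in> pa_interval m n (fst \<omega>) j) = (j \<in> T)} \<in> sets ?M"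
        by (cases "j \<in> T") (simp_all add: P[OF \<open>j \<in> {1..n}\<close>, simplified] sets.sets_Collect_neg)
    qed simp
    finally show "S -` {T} \<inter> space ?M \<in> sets ?M" .
  qed
  hence "(\<lambda>\<omega>. (\<lambda>T. THE j. j \<in> T) (S \<omega>)) \<in> measurable ?M (count_space UNIV)"
    by (rule measurable_compose) simp
  thus ?thesis
    by (simp add: S_def pa_vertex_def)
qed

lemma mg_degree_pa_graph:
  "mg_degree (pa_graph m n w l) j =
     (\<Sum>k\<in>{1..m * n}. of_bool (pa_vertex m n w (pa_R m n w k) = j) + of_bool (pa_vertex m n w (l k) = j))"
  unfolding mg_degree_def pa_graph_def
  by (simp add: image_mset.compositionality o_def sum_unfold_sum_mset[symmetric])
     (auto intro!: sum.cong)

lemma mg_degree_pa_graph_measurable [measurable]: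
  "(\<lambda>\<omega>. mg_degree (pa_graph m n (fst \<omega>) (snd \<omega>)) j) \<in> measurable (pa_space m n) (count_space UNIV)"
proof -
  let ?M = "pa_w_space m n \<Otimes>\<^sub>M pa_l_space m n"
  have "(\<lambda>\<omega>. mg_degree (pa_graph m n (fst \<omega>) (snd \<omega>)) j) \<in> measurable ?M (count_space UNIV)"
    unfolding mg_degree_pa_graph
  proof (rule measurable_sum_nat)
    fix k assume k: "k \<in> {1..m * n}"
    have [measurable]: "(\<lambda>\<omega>. pa_R m n (fst \<omega>) k) \<in> borel_measurable ?M"
      using k by (intro measurable_compose[OF measurable_fst pa_R_measurable]) auto
    have [measurable]: "(\<lambda>\<omega>. snd \<omega> k) \<in> borel_measurable ?M"
      using k by (intro measurable_compose[OF measurable_snd measurable_component_singleton]) auto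
    show "(\<lambda>\<omega>. of_bool (pa_vertex m n (fst \<omega>) (pa_R m n (fst \<omega>) k) = j) +
                of_bool (pa_vertex m n (fst \<omega>) (snd \<omega> k) = j) :: nat) \<in> measurable ?M (count_space UNIV)"
      by measurable
  qed
  thus ?thesis
    by (simp cong: measurable_cong_sets)
qed

end

theory Submission
  imports Defs "HOL-Real_Asymp.Real_Asymp"
begin

text \<open>
  The normalisation by \<open>W (m n + 1)\<close> cancels in the conditional probability that \<open>l k\<close> lands in
  the interval of \<open>j\<close>, which is at most \<open>\<Delta> j / (2 sqrt (W k * W (m (j - 1))))\<close> with
  \<open>\<Delta> j = W (m j) - W (m (j - 1))\<close>. With high probability \<open>W k \<ge> (1 - \<epsilon>) k\<close> for all relevant \<open>k\<close>
  and \<open>\<Delta> j \<le> (1 + \<epsilon>) ln n\<close> for all \<open>j\<close>; then the conditional mean of the in-degree of \<open>j\<close> is at most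
  \<open>\<mu> = (1 + o(1)) (sqrt (n / j) - 1) ln n\<close>. A Chernoff bound with base \<open>z\<close> makes the probability of
  exceeding \<open>z \<mu>\<close> roughly \<open>exp (- \<mu> (z ln z + 1 - z))\<close>, and \<open>z > z(\<sigma>)\<close> is exactly what pushes this
  below \<open>1 / n\<close> by a power of \<open>n\<close>, so that a union bound over \<open>j\<close> applies.
\<close>

section \<open>The root\<close>

text \<open>The derivative is \<open>ln u\<close>, positive for \<open>u > 1\<close>. It vanishes at
  1, so only the open interval is differentiated, with continuity at the endpoints.\<close>

lemma pa_phi_denominator_strict_mono:
  fixes x y :: real
  assumes "1 \<le> x" "x < y"
  shows "x * ln x + 1 - x < y * ln y + 1 - y"
proof (rule DERIV_pos_imp_increasing_open[OF assms(2)])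
  fix u assume "x < u" "u < y"
  then have "((\<lambda>z. z * ln z + 1 - z) has_real_derivative ln u) (at u)"
    using assms by (auto intro!: derivative_eq_intros)
  moreover have "ln u > 0" using \<open>x < u\<close> assms by simp
  ultimately show "\<exists>d. ((\<lambda>z. z * ln z + 1 - z) has_real_derivative d) (at u) \<and> 0 < d" by blast
qed (use assms in \<open>auto intro!: continuous_intros\<close>)

lemma pa_root_level_pos:
  assumes "0 < \<sigma>" "\<sigma> < 1"
  shows "0 < (1 - \<sigma> :: real) powr (-1/2) - 1"
  using powr_less_mono2_neg[of "-1/2" "1 - \<sigma>" 1] assms by simp

text \<open>The level is nonzero, so inverses may be taken on both sides; this trades the decreasing
  \<open>pa_phi\<close> for its increasing denominator.\<close>

lemma pa_is_root_iff:
  assumes "0 < \<sigma>" "\<sigma> < 1"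
  shows "pa_is_root \<sigma> z \<longleftrightarrow> 1 < z \<and> z * ln z + 1 - z = inverse ((1 - \<sigma>) powr (-1/2) - 1)"
  using pa_root_level_pos[OF assms] by (auto simp: pa_is_root_def pa_phi_def inverse_eq_imp_eq)

text \<open>The function \<open>?f\<close> is 0 at 1 and unbounded, so it attains the positive value
  \<open>y\<close>; strict monotonicity makes the point unique.\<close>

lemma pa_root_ex1:
  assumes "0 < \<sigma>" "\<sigma> < 1"
  shows "\<exists>!z. pa_is_root \<sigma> z"
proof -
  define y where "y = inverse ((1 - \<sigma>) powr (-1/2) - 1)"
  let ?f = "\<lambda>z::real. z * ln z + 1 - z"
  have y: "y > 0" using pa_root_level_pos[OF assms] by (simp add: y_def)
  have "filterlim ?f at_top at_top" by real_asymp
  then have "eventually (\<lambda>z. ?f z \<ge> y) at_top" by (simp add: filterlim_at_top)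
  then obtain b where b: "\<And>z. z \<ge> b \<Longrightarrow> ?f z \<ge> y" by (auto simp: eventually_at_top_linorder)
  have "\<exists>z\<ge>1. z \<le> max b 1 \<and> ?f z = y"
    using b[of "max b 1"] y by (intro IVT') (auto intro!: continuous_intros)
  then obtain z where z: "z \<ge> 1" "?f z = y" by blast
  \<comment> \<open>Since \<open>?f 1 = 0 < y\<close>, the point found on the closed ray is not its
    endpoint.\<close>
  then have "z > 1" using y by (cases "z = 1") auto
  show ?thesis
  proof (rule ex1I[of _ z])
    show "pa_is_root \<sigma> z" using z \<open>z > 1\<close> by (simp add: pa_is_root_iff[OF assms] y_def)
    show "u = z" if "pa_is_root \<sigma> u" for u
      using that z \<open>z > 1\<close> pa_phi_denominator_strict_mono[of u z] pa_phi_denominator_strict_mono[of z u]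
      by (force simp: pa_is_root_iff[OF assms] y_def)
  qed
qed

lemma pa_root_props:
  assumes "0 < \<sigma>" "\<sigma> < 1"
  shows "1 < pa_root \<sigma>"
    and "pa_root \<sigma> * ln (pa_root \<sigma>) + 1 - pa_root \<sigma> = inverse ((1 - \<sigma>) powr (-1/2) - 1)"
  using theI'[OF pa_root_ex1[OF assms]] by (simp_all add: pa_root_def pa_is_root_iff[OF assms])

text \<open>As \<sigma> tends to 0 the level of the increasing denominator tends to infinity; a root
  below \<open>Z\<close> would keep that level below its value at \<open>Z\<close>.\<close>

lemma pa_root_at_top: "filterlim pa_root at_top (at_right 0)"
  unfolding filterlim_at_top_ge[where c = 1]
proof safe
  fix Z :: real assume Z: "1 \<le> Z"
  have "filterlim (\<lambda>\<sigma>::real. inverse ((1 - \<sigma>) powr (-1/2) - 1)) at_top (at_right 0)" by real_asymp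
  then have "eventually (\<lambda>\<sigma>::real. inverse ((1 - \<sigma>) powr (-1/2) - 1) > Z * ln Z + 1 - Z) (at_right 0)"
    by (simp add: filterlim_at_top_dense)
  moreover have "eventually (\<lambda>\<sigma>::real. \<sigma> \<in> {0<..<1}) (at_right 0)"
    by (rule eventually_at_right_real) simp
  ultimately show "eventually (\<lambda>\<sigma>. Z \<le> pa_root \<sigma>) (at_right 0)"
  proof eventually_elim
    case (elim \<sigma>)
    then show ?case
      using pa_root_props[of \<sigma>] pa_phi_denominator_strict_mono[of "pa_root \<sigma>" Z] by force
  qed
qed

text \<open>Write p for the root, so that \<open>f\<close> takes the value 1/c at p, with c
  asymptotic to \<sigma>/2. The quotient to be shown to tend to 1 is p \<sigma> ln(1/\<sigma>) / 2.
  Splitting ln(1/\<sigma>) as ln(1/c) + ln(c/\<sigma>) makes the first logarithm a function of p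
  alone and leaves the second bounded.\<close>

lemma pa_root_asymp: "pa_root \<sim>[at_right 0] (\<lambda>\<sigma>. 2 * inverse (\<sigma> * ln (1 / \<sigma>)))"
proof (rule asymp_equivI')
  define f where "f = (\<lambda>z::real. z * ln z + 1 - z)"
  define c where "c = (\<lambda>\<sigma>::real. (1 - \<sigma>) powr (-1/2) - 1)"
  \<comment> \<open>Here \<open>f z\<close> behaves like \<open>z * ln z\<close>, so
    \<open>ln (f z)\<close> behaves like \<open>ln z\<close>. The limit \<open>l2\<close> below
    removes the bounded term \<open>ln (c \<sigma> / \<sigma>)\<close>.\<close>
  have "((\<lambda>z. z * ln (f z) / f z) \<longlongrightarrow> 1) at_top" unfolding f_def by real_asymp
  note l1 = filterlim_compose[OF this pa_root_at_top]
  have "((\<lambda>z. z / f z) \<longlongrightarrow> 0) at_top" unfolding f_def by real_asymp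
  note l2 = filterlim_compose[OF this pa_root_at_top]
  have l3: "((\<lambda>\<sigma>. \<sigma> / (2 * c \<sigma>)) \<longlongrightarrow> 1) (at_right 0)" unfolding c_def by real_asymp
  have l4: "((\<lambda>\<sigma>. ln (c \<sigma> / \<sigma>)) \<longlongrightarrow> ln (1/2)) (at_right 0)" unfolding c_def by real_asymp
  have "((\<lambda>\<sigma>. \<sigma> / (2 * c \<sigma>) * (pa_root \<sigma> * ln (f (pa_root \<sigma>)) / f (pa_root \<sigma>)
            + pa_root \<sigma> / f (pa_root \<sigma>) * ln (c \<sigma> / \<sigma>))) \<longlongrightarrow> 1 * (1 + 0 * ln (1/2))) (at_right 0)"
    by (intro tendsto_intros l1 l2 l3 l4)
  moreover have "eventually (\<lambda>\<sigma>::real. \<sigma> \<in> {0<..<1}) (at_right 0)"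
    by (rule eventually_at_right_real) simp
  then have "eventually (\<lambda>\<sigma>. \<sigma> / (2 * c \<sigma>) * (pa_root \<sigma> * ln (f (pa_root \<sigma>)) / f (pa_root \<sigma>)
            + pa_root \<sigma> / f (pa_root \<sigma>) * ln (c \<sigma> / \<sigma>))
            = pa_root \<sigma> / (2 * inverse (\<sigma> * ln (1 / \<sigma>)))) (at_right 0)"
  proof eventually_elim
    case (elim \<sigma>)
    then have s: "0 < \<sigma>" "\<sigma> < 1" by auto
    have c: "c \<sigma> > 0" using pa_root_level_pos[OF s] by (simp add: c_def)
    have fz: "f (pa_root \<sigma>) = inverse (c \<sigma>)" using pa_root_props[OF s] by (simp add: f_def c_def)
    have ln: "ln (1 / \<sigma>) = ln (inverse (c \<sigma>)) + ln (c \<sigma> / \<sigma>)"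
      using s c by (simp add: ln_div ln_inverse)
    \<comment> \<open>Pure algebra, in which the root and both logarithms are atoms.\<close>
    have "\<sigma> / (2 * d) * (p * x / inverse d + p / inverse d * y) = p / (2 * inverse (\<sigma> * (x + y)))"
      if "0 < d" for p x y d
    proof -
      have "\<sigma> / (2 * d) * (p * x / inverse d + p / inverse d * y) = p * (\<sigma> * (x + y)) / 2"
        using that by (simp add: field_simps)
      then show ?thesis by (simp add: divide_simps)
    qed
    note this[OF c, of "pa_root \<sigma>" "ln (inverse (c \<sigma>))" "ln (c \<sigma> / \<sigma>)"]
    then show ?case unfolding fz ln .
  qed
  ultimately show "((\<lambda>\<sigma>. pa_root \<sigma> / (2 * inverse (\<sigma> * ln (1 / \<sigma>)))) \<longlongrightarrow> 1) (at_right 0)"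
    by (auto elim!: Lim_transform_eventually)
qed

section \<open>Chernoff bounds for the two product laws\<close>

text \<open>Markov's inequality for a product of functions of separate coordinates, whose integral
  factorises. Mass 1 is asked only on \<open>I\<close>: the endpoint density at index 0, for
  instance, is identically zero.\<close>

lemma emeasure_PiM_prod_ge:
  fixes f :: "'i \<Rightarrow> 'a \<Rightarrow> ennreal" and c :: real
  assumes "product_sigma_finite M" "finite I" "S \<subseteq> I" "0 < c"
    and one: "\<And>i. i \<in> I \<Longrightarrow> emeasure (M i) (space (M i)) = 1"
    and f: "\<And>i. i \<in> S \<Longrightarrow> f i \<in> borel_measurable (M i)"
  shows "emeasure (Pi\<^sub>M I M) {x \<in> space (Pi\<^sub>M I M). ennreal c \<le> (\<Prod>i\<in>S. f i (x i))}
           \<le> ennreal (1 / c) * (\<Prod>i\<in>S. \<integral>\<^sup>+x. f i x \<partial>M i)"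
proof -
  interpret product_sigma_finite M by fact
  \<comment> \<open>Padding with the constant 1 extends the product from \<open>S\<close> to all of
    \<open>I\<close>; the added factors integrate to 1.\<close>
  define g where "g i = (if i \<in> S then f i else (\<lambda>_. 1))" for i
  have [measurable]: "(\<lambda>x. \<Prod>i\<in>S. f i (x i)) \<in> borel_measurable (Pi\<^sub>M I M)"
  proof (rule borel_measurable_prod_ennreal)
    fix i assume i: "i \<in> S"
    show "(\<lambda>x. f i (x i)) \<in> borel_measurable (Pi\<^sub>M I M)"
      using measurable_compose[OF measurable_component_singleton[of i I M] f[OF i]] i assms(3) by auto
  qed
  \<comment> \<open>Markov's inequality is applied in the normalised form with threshold 1.\<close>
  have "ennreal c \<le> p \<longleftrightarrow> 1 \<le> ennreal (1 / c) * p" for p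
  proof
    have c: "ennreal (1 / c) * ennreal c = 1" "ennreal c * ennreal (1 / c) = 1"
      using assms(4) by (simp_all flip: ennreal_mult'')
    show "1 \<le> ennreal (1 / c) * p" if "ennreal c \<le> p"
      using mult_left_mono[OF that, of "ennreal (1 / c)"] c by simp
    show "ennreal c \<le> p" if "1 \<le> ennreal (1 / c) * p"
      using mult_left_mono[OF that, of "ennreal c"] c by (simp flip: mult.assoc)
  qed
  then have "emeasure (Pi\<^sub>M I M) {x \<in> space (Pi\<^sub>M I M). ennreal c \<le> (\<Prod>i\<in>S. f i (x i))}
      = emeasure (Pi\<^sub>M I M) {x \<in> space (Pi\<^sub>M I M). 1 \<le> ennreal (1 / c) * (\<Prod>i\<in>S. f i (x i))}"
    by simp
  also have "\<dots> \<le> ennreal (1 / c) *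
      (\<integral>\<^sup>+x. (\<Prod>i\<in>S. f i (x i)) * indicator (space (Pi\<^sub>M I M)) x \<partial>Pi\<^sub>M I M)"
    by (rule nn_integral_Markov_inequality) auto
  also have "(\<integral>\<^sup>+x. (\<Prod>i\<in>S. f i (x i)) * indicator (space (Pi\<^sub>M I M)) x \<partial>Pi\<^sub>M I M)
      = (\<integral>\<^sup>+x. (\<Prod>i\<in>I. g i (x i)) \<partial>Pi\<^sub>M I M)"
  proof (rule nn_integral_cong)
    fix x assume "x \<in> space (Pi\<^sub>M I M)"
    moreover have "(\<Prod>i\<in>S. f i (x i)) = (\<Prod>i\<in>I. g i (x i))"
      using assms by (intro prod.mono_neutral_cong_left) (auto simp: g_def)
    ultimately show "(\<Prod>i\<in>S. f i (x i)) * indicator (space (Pi\<^sub>M I M)) x = (\<Prod>i\<in>I. g i (x i))"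
      by simp
  qed
  also have "\<dots> = (\<Prod>i\<in>I. integral\<^sup>N (M i) (g i))"
    using f assms(2) by (intro product_nn_integral_prod) (auto simp: g_def)
  also have "\<dots> = (\<Prod>i\<in>S. \<integral>\<^sup>+x. f i x \<partial>M i)"
    using assms one by (intro prod.mono_neutral_cong_right) (auto simp: g_def)
  finally show ?thesis .
qed

text \<open>Exponential tilting: exp(t x) times the density of rate 1 is 1/(1 - t) times the density
  of rate 1 - t, which has total mass 1.\<close>

lemma nn_integral_exp_exponential:
  fixes t :: real
  assumes "t < 1"
  shows "(\<integral>\<^sup>+x. ennreal (exp (t * x)) \<partial>density lborel (exponential_density 1)) = ennreal (1 / (1 - t))"
proof -
  interpret prob_space "density lborel (exponential_density (1 - t))"
    using assms by (intro prob_space_exponential_density) simp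
  have "(\<integral>\<^sup>+x. ennreal (exp (t * x)) \<partial>density lborel (exponential_density 1))
      = (\<integral>\<^sup>+x. ennreal (exponential_density 1 x) * ennreal (exp (t * x)) \<partial>lborel)"
    by (subst nn_integral_density) auto
  also have "\<dots> = (\<integral>\<^sup>+x. ennreal (1 / (1 - t)) * ennreal (exponential_density (1 - t) x) \<partial>lborel)"
  proof (rule nn_integral_cong)
    fix x :: real
    show "ennreal (exponential_density 1 x) * ennreal (exp (t * x))
        = ennreal (1 / (1 - t)) * ennreal (exponential_density (1 - t) x)"
      using assms
      by (auto simp: erlang_density_def simp flip: ennreal_mult'' exp_add intro!: arg_cong[where f = ennreal])
         (simp add: algebra_simps)
  qed
  also have "\<dots> = ennreal (1 / (1 - t)) * (\<integral>\<^sup>+x. ennreal (exponential_density (1 - t) x) \<partial>lborel)"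
    by (rule nn_integral_cmult) simp
  also have "(\<integral>\<^sup>+x. ennreal (exponential_density (1 - t) x) \<partial>lborel) = 1"
    using emeasure_space_1 by (simp add: emeasure_density)
  finally show ?thesis by simp
qed

text \<open>Keeping the factor \<open>t\<close> on both sides of the event serves both tails: the
  upper one for positive \<open>t\<close>, the lower one for negative \<open>t\<close>.\<close>

lemma pa_w_law_Chernoff:
  fixes t x :: real
  assumes "S \<subseteq> {1..m * n + 1}" "t < 1"
  shows "emeasure (pa_w_law m n) {w \<in> space (pa_w_law m n). t * x \<le> t * (\<Sum>i\<in>S. w i)}
           \<le> ennreal (exp (- t * x) * (1 / (1 - t)) ^ card S)"
proof -
  let ?E = "density lborel (exponential_density 1) :: real measure"
  have E: "prob_space ?E" by (rule prob_space_exponential_density) simp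
  from prob_space.emeasure_space_1[OF E] have E1: "emeasure ?E UNIV = 1" by simp
  have fin: "finite S" using assms by (auto intro: finite_subset)
  have "emeasure (pa_w_law m n) {w \<in> space (pa_w_law m n). t * x \<le> t * (\<Sum>i\<in>S. w i)}
      = emeasure (pa_w_law m n)
          {w \<in> space (pa_w_law m n). ennreal (exp (t * x)) \<le> (\<Prod>i\<in>S. ennreal (exp (t * w i)))}"
    by (simp add: prod_ennreal flip: exp_sum[OF fin] sum_distrib_left)
  also have "\<dots> \<le> ennreal (1 / exp (t * x)) * (\<Prod>i\<in>S. \<integral>\<^sup>+x. ennreal (exp (t * x)) \<partial>?E)"
    unfolding pa_w_law_def using E assms(1)
    by (intro emeasure_PiM_prod_ge)
       (auto simp: product_sigma_finite_def E1 prob_space_imp_sigma_finite)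
  also have "\<dots> = ennreal (exp (- t * x) * (1 / (1 - t)) ^ card S)"
    using assms(2) unfolding nn_integral_exp_exponential[OF assms(2)]
    by (simp add: ennreal_power exp_minus inverse_eq_divide flip: ennreal_mult'')
  finally show ?thesis .
qed

section \<open>Positivity and monotonicity of the partial sums and their ratios\<close>

lemma pa_W_diff:
  assumes "i \<le> j"
  shows "pa_W w j - pa_W w i = (\<Sum>k\<in>{i+1..j}. w k)"
proof -
  have "{1..j} = {1..i} \<union> {i+1..j}" using assms by auto
  then have "pa_W w j = pa_W w i + (\<Sum>k\<in>{i+1..j}. w k)"
    unfolding pa_W_def by (simp only:) (rule sum.union_disjoint, auto)
  then show ?thesis by simp
qed

lemma pa_W_strict_mono:
  assumes "\<forall>i\<in>{1..N}. 0 < w i" "i < j" "j \<le> N"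
  shows "pa_W w i < pa_W w j"
proof -
  have "(\<Sum>k\<in>{i+1..j}. w k) > 0"
    using assms by (intro sum_pos) auto
  then show ?thesis using pa_W_diff[of i j w] assms by simp
qed

lemma pa_W_pos:
  assumes "\<forall>i\<in>{1..N}. 0 < w i" "0 < j" "j \<le> N"
  shows "0 < pa_W w j"
  using pa_W_strict_mono[OF assms] by (simp add: pa_W_def)

lemma pa_R_pos:
  assumes "\<forall>i\<in>{1..m * n + 1}. 0 < w i" "0 < k" "k \<le> m * n + 1"
  shows "0 < pa_R m n w k"
  using pa_W_pos[OF assms] pa_W_pos[OF assms(1), of "m * n + 1"] by (simp add: pa_R_def)

lemma pa_R_strict_mono:
  assumes "\<forall>i\<in>{1..m * n + 1}. 0 < w i" "i < j" "j \<le> m * n + 1"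
  shows "pa_R m n w i < pa_R m n w j"
  using pa_W_strict_mono[OF assms] pa_W_pos[OF assms(1), of "m * n + 1"]
  by (simp add: pa_R_def divide_strict_right_mono)

lemma pa_R_mono:
  assumes "\<forall>i\<in>{1..m * n + 1}. 0 < w i" "i \<le> j" "j \<le> m * n + 1"
  shows "pa_R m n w i \<le> pa_R m n w j"
  using pa_R_strict_mono[OF assms(1), of i j] assms by (cases "i = j") auto

text \<open>The density decreases on its support and is zero beyond \<open>r\<close>, so its value
  at the left endpoint \<open>x\<close> dominates it on the whole interval.\<close>

lemma emeasure_pa_end_density_Ioc:
  assumes "0 < x" "x \<le> y" "0 < r"
  shows "emeasure (density lborel (pa_end_density r)) {x<..y} \<le> ennreal ((y - x) / (2 * sqrt (r * x)))"
proof -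
  have "emeasure (density lborel (pa_end_density r)) {x<..y}
      = (\<integral>\<^sup>+u. ennreal (pa_end_density r u) * indicator {x<..y} u \<partial>lborel)"
    by (simp add: emeasure_density)
  also have "\<dots> \<le> (\<integral>\<^sup>+u. ennreal (1 / (2 * sqrt (r * x))) * indicator {x<..y} u \<partial>lborel)"
    using assms
    by (intro nn_integral_mono) (auto simp: pa_end_density_def indicator_def intro!: divide_left_mono ennreal_leI)
  also have "\<dots> = ennreal ((y - x) / (2 * sqrt (r * x)))"
    using assms by (simp add: nn_integral_cmult flip: ennreal_mult'')
  finally show ?thesis .
qed

text \<open>The hits of \<open>A\<close> are independent, so the expectation of z to their number is
  a product of factors at most 1 + (z - 1) q, each bounded by exp((z - 1) q). Base \<open>z\<close>
  is the optimal choice for exceeding \<open>z\<close> times a Poisson mean.\<close>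

lemma pa_l_law_Chernoff:
  fixes z t :: real and q :: "nat \<Rightarrow> real"
  assumes w: "\<forall>i\<in>{1..m * n + 1}. 0 < w i" and K: "K \<subseteq> {1..m * n}" and "1 < z"
    and A [measurable]: "A \<in> sets borel"
    and q0: "\<And>k. k \<in> K \<Longrightarrow> 0 \<le> q k"
    and q: "\<And>k. k \<in> K \<Longrightarrow> emeasure (density lborel (pa_end_density (pa_R m n w k))) A \<le> ennreal (q k)"
  shows "emeasure (pa_l_law m n w) {l \<in> space (pa_l_law m n w). t \<le> real (card {k\<in>K. l k \<in> A})}
           \<le> ennreal (exp ((z - 1) * (\<Sum>k\<in>K. q k) - t * ln z))"
proof -
  let ?M = "\<lambda>k. density lborel (pa_end_density (pa_R m n w k))"
  \<comment> \<open>This equals \<open>z\<close> on \<open>A\<close> and 1 elsewhere; the additive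
    form makes its integral affine in the measure of \<open>A\<close>.\<close>
  let ?f = "\<lambda>k x::real. 1 + ennreal (z - 1) * indicator A x"
  have fin: "finite K" using K by (auto intro: finite_subset)
  have prob: "prob_space (?M k)" if "k \<in> {1..m * n}" for k
    using that pa_R_pos[OF w, of k] by (intro prob_space_pa_end_density) auto
  \<comment> \<open>Sigma-finiteness is required at every index, also outside
    \<open>{1..m * n}\<close>, where positivity of \<open>pa_R m n w k\<close> may fail.\<close>
  have "finite_measure (?M k)" for k
    using emeasure_pa_end_density_le[of "pa_R m n w k" UNIV]
    by (intro finite_measureI) (auto simp: top_unique)
  then have sf: "product_sigma_finite ?M"
    by (simp add: product_sigma_finite_def finite_measure.sigma_finite_measure)
  have "(\<Prod>k\<in>K. ?f k (l k)) = ennreal (exp (real (card {k\<in>K. l k \<in> A}) * ln z))" for l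
  proof -
    have "(\<Prod>k\<in>K. ?f k (l k)) = (\<Prod>k\<in>K. if l k \<in> A then ennreal z else 1)"
    proof -
      have "1 + ennreal (z - 1) = ennreal z"
        using \<open>1 < z\<close> ennreal_plus[of 1 "z - 1"] by simp
      then show ?thesis by (intro prod.cong) auto
    qed
    also have "\<dots> = ennreal z ^ card {k\<in>K. l k \<in> A}"
      using fin by (simp add: prod.If_cases Int_def conj_commute)
    also have "\<dots> = ennreal (exp (real (card {k\<in>K. l k \<in> A}) * ln z))"
      using \<open>1 < z\<close> by (simp add: ennreal_power exp_of_nat_mult)
    finally show ?thesis .
  qed
  then have "{l \<in> space (pa_l_law m n w). t \<le> real (card {k\<in>K. l k \<in> A})}
      = {l \<in> space (pa_l_law m n w). ennreal (exp (t * ln z)) \<le> (\<Prod>k\<in>K. ?f k (l k))}"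
    using \<open>1 < z\<close> by simp
  then have "emeasure (pa_l_law m n w) {l \<in> space (pa_l_law m n w). t \<le> real (card {k\<in>K. l k \<in> A})}
      = emeasure (pa_l_law m n w)
          {l \<in> space (pa_l_law m n w). ennreal (exp (t * ln z)) \<le> (\<Prod>k\<in>K. ?f k (l k))}"
    by simp
  also have "\<dots> \<le> ennreal (1 / exp (t * ln z)) * (\<Prod>k\<in>K. \<integral>\<^sup>+x. ?f k x \<partial>?M k)"
    unfolding pa_l_law_def using K
    by (intro emeasure_PiM_prod_ge sf prob_space.emeasure_space_1 prob) auto
  also have "\<dots> \<le> ennreal (1 / exp (t * ln z)) * (\<Prod>k\<in>K. ennreal (exp ((z - 1) * q k)))"
  proof (intro mult_left_mono prod_mono_ennreal)
    fix k assume k: "k \<in> K"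
    then have "k \<in> {1..m * n}" using K by auto
    note prob_space.emeasure_space_1[OF prob[OF this]]
    then have "(\<integral>\<^sup>+x. ?f k x \<partial>?M k) = 1 + ennreal (z - 1) * emeasure (?M k) A"
      by (subst nn_integral_add) (auto simp: nn_integral_cmult)
    also have "\<dots> \<le> 1 + ennreal (z - 1) * ennreal (q k)"
      by (intro add_mono mult_left_mono q k) auto
    also have "\<dots> = ennreal (1 + (z - 1) * q k)"
      using \<open>1 < z\<close> q0[OF k] by (simp flip: ennreal_mult'' ennreal_plus ennreal_1)
    also have "\<dots> \<le> ennreal (exp ((z - 1) * q k))"
      by (intro ennreal_leI exp_ge_add_one_self)
    finally show "(\<integral>\<^sup>+x. ?f k x \<partial>?M k) \<le> ennreal (exp ((z - 1) * q k))" .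
  qed auto
  also have "\<dots> = ennreal (exp ((z - 1) * (\<Sum>k\<in>K. q k) - t * ln z))"
    using fin
    by (simp add: prod_ennreal exp_diff sum_distrib_left exp_sum prod_nonneg flip: ennreal_mult)
  finally show ?thesis .
qed

text \<open>The law of the pair is integrated over \<open>w\<close>: on \<open>G\<close> the section
  of \<open>B\<close> has conditional measure at most \<open>c\<close>, and elsewhere the trivial
  bound 1 costs only the probability of the complement.\<close>

lemma emeasure_pa_space_le:
  assumes B: "B \<in> sets (pa_space m n)" and G: "G \<in> sets (pa_w_law m n)"
    and le: "\<And>w. w \<in> G \<Longrightarrow> emeasure (pa_l_law m n w) {l \<in> space (pa_l_law m n w). (w, l) \<in> B} \<le> c"
  shows "emeasure (pa_space m n) B \<le> emeasure (pa_w_law m n) (space (pa_w_law m n) - G) + c"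
proof -
  let ?P = "pa_w_space m n \<Otimes>\<^sub>M pa_l_space m n"
  interpret prob_space "pa_w_law m n" by (rule prob_space_pa_w_law)
  have [measurable]: "B \<in> sets ?P" using B by simp
  have "emeasure (pa_space m n) B
      = (\<integral>\<^sup>+w. emeasure (pa_l_law m n w \<bind> (\<lambda>l. return ?P (w, l))) B \<partial>pa_w_law m n)"
    unfolding pa_space_def
  proof (rule emeasure_bind)
    show "(\<lambda>w. pa_l_law m n w \<bind> (\<lambda>l. return ?P (w, l))) \<in> measurable (pa_w_law m n) (subprob_algebra ?P)"
      by measurable
  qed (use not_empty B in auto)
  also have "\<dots> \<le> (\<integral>\<^sup>+w. indicator (space (pa_w_law m n) - G) w + c \<partial>pa_w_law m n)"
  proof (rule nn_integral_mono)
    fix w assume w: "w \<in> space (pa_w_law m n)"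
    then have w': "w \<in> space (pa_w_space m n)"
      using sets_eq_imp_space_eq[OF sets_pa_w_law] by metis
    interpret l: subprob_space "pa_l_law m n w" by (rule subprob_space_pa_l_law)
    have "emeasure (pa_l_law m n w \<bind> (\<lambda>l. return ?P (w, l))) B
        = (\<integral>\<^sup>+l. emeasure (return ?P (w, l)) B \<partial>pa_l_law m n w)"
    proof (rule emeasure_bind)
      show "(\<lambda>l. return ?P (w, l)) \<in> measurable (pa_l_law m n w) (subprob_algebra ?P)"
        using w' by measurable
    qed (use l.subprob_not_empty B in auto)
    also have "\<dots> = (\<integral>\<^sup>+l. indicator {l \<in> space (pa_l_law m n w). (w, l) \<in> B} l \<partial>pa_l_law m n w)"
      using B by (intro nn_integral_cong) (auto simp: indicator_def)
    also have "\<dots> = emeasure (pa_l_law m n w) {l \<in> space (pa_l_law m n w). (w, l) \<in> B}"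
      using w' by (intro nn_integral_indicator) measurable
    finally have eq: "emeasure (pa_l_law m n w \<bind> (\<lambda>l. return ?P (w, l))) B
        = emeasure (pa_l_law m n w) {l \<in> space (pa_l_law m n w). (w, l) \<in> B}" .
    show "emeasure (pa_l_law m n w \<bind> (\<lambda>l. return ?P (w, l))) B
        \<le> indicator (space (pa_w_law m n) - G) w + c"
    proof (cases "w \<in> G")
      case True
      then show ?thesis using le[OF True] eq by simp
    next
      case False
      \<comment> \<open>Off \<open>G\<close> some gap may fail to be positive; the kernel is still a
        sub-probability, which is enough here.\<close>
      have "emeasure (pa_l_law m n w) {l \<in> space (pa_l_law m n w). (w, l) \<in> B} \<le> 1"
        by (rule l.subprob_emeasure_le_1)
      also have "(1::ennreal) \<le> 1 + c" by simp
      finally show ?thesis using False w eq by simp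
    qed
  qed
  also have "\<dots> = emeasure (pa_w_law m n) (space (pa_w_law m n) - G) + c"
  proof -
    have "space (pa_w_law m n) - G \<in> sets (pa_w_law m n)" by (rule sets.compl_sets[OF G])
    then show ?thesis by (subst nn_integral_add) (auto simp: emeasure_space_1 simp del: sets_pa_w_law)
  qed
  finally show ?thesis .
qed

section \<open>Degrees conditionally on the gaps\<close>

lemma pa_interval_unique:
  assumes w: "\<forall>i\<in>{1..m * n + 1}. 0 < w i"
    and "i \<in> {1..n}" "j \<in> {1..n}" "x \<in> pa_interval m n w i" "x \<in> pa_interval m n w j"
  shows "i = j"
proof -
  have "\<not> i < j" if "i \<in> {1..n}" "j \<in> {1..n}" "x \<in> pa_interval m n w i" "x \<in> pa_interval m n w j" for i j
  proof
    assume "i < j"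
    then have "m * i \<le> m * (j - 1)" "m * (j - 1) \<le> m * n + 1"
      using that by (auto intro!: mult_le_mono2 le_SucI)
    from pa_R_mono[OF w this] that(3,4) show False by (simp add: pa_interval_def)
  qed
  from this[of i j] this[of j i] assms show ?thesis by fastforce
qed

text \<open>For positive gaps the intervals partition (0, R(m n)], so the definite description in
  \<open>pa_vertex\<close> denotes. The witness is the first vertex whose right end reaches
  \<open>x\<close>.\<close>

lemma pa_vertex_interval:
  assumes w: "\<forall>i\<in>{1..m * n + 1}. 0 < w i" and x: "0 < x" "x \<le> pa_R m n w (m * n)"
  shows "x \<in> pa_interval m n w (pa_vertex m n w x)"
proof -
  define j where "j = (LEAST j. x \<le> pa_R m n w (m * j))"
  have j: "x \<le> pa_R m n w (m * j)" "j \<le> n"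
    using x(2) unfolding j_def by (rule LeastI, rule Least_le)
  \<comment> \<open>The left end of the first interval is \<open>pa_R m n w 0 = 0\<close>, strictly
    below \<open>x\<close>.\<close>
  have "j \<noteq> 0" using j(1) x(1) by (intro notI) (simp add: pa_R_def pa_W_def)
  then have "\<not> x \<le> pa_R m n w (m * (j - 1))"
    unfolding j_def by (intro not_less_Least) simp
  then have "j \<in> {1..n} \<and> x \<in> pa_interval m n w j"
    using j \<open>j \<noteq> 0\<close> by (auto simp: pa_interval_def)
  then have "\<exists>!j. j \<in> {1..n} \<and> x \<in> pa_interval m n w j"
    using pa_interval_unique[OF w] by blast
  from theI'[OF this] show ?thesis by (simp add: pa_vertex_def)
qed

text \<open>Edge k has both ends at or below R(k). Hence edges before the block of \<open>j\<close>
  cannot touch it, the \<open>m\<close> edges of the block contribute at most 2 each, and a later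
  edge can hit \<open>j\<close> only through \<open>l k\<close>.\<close>

lemma mg_degree_pa_graph_le:
  assumes w: "\<forall>i\<in>{1..m * n + 1}. 0 < w i"
    and l: "\<forall>k\<in>{1..m * n}. 0 < l k \<and> l k \<le> pa_R m n w k"
    and j: "1 \<le> j" "j \<le> n"
  shows "mg_degree (pa_graph m n w l) j
           \<le> 2 * m + card {k \<in> {m * j + 1..m * n}. l k \<in> pa_interval m n w j}"
proof -
  let ?R = "pa_R m n w" and ?V = "pa_vertex m n w"
  let ?A = "{m * (j - 1) + 1..m * j}"
  have mj: "m * (j - 1) \<le> m * n" "m * j \<le> m * n" using j by auto
  have R: "0 < ?R k" if "k \<in> {1..m * n}" for k
    using that by (intro pa_R_pos[OF w]) auto
  have V: "x \<in> pa_interval m n w (?V x)" if "k \<in> {1..m * n}" "0 < x" "x \<le> ?R k" for k x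
    using that pa_R_mono[OF w, of k "m * n"] by (intro pa_vertex_interval[OF w]) auto
  \<comment> \<open>Stated for any point \<open>x\<close> up to \<open>?R k\<close>, so that it
    covers both ends of the edge.\<close>
  have low: "m * (j - 1) < k" if "k \<in> {1..m * n}" "0 < x" "x \<le> ?R k" "?V x = j" for k x
  proof (rule ccontr)
    assume "\<not> m * (j - 1) < k"
    then have "?R k \<le> ?R (m * (j - 1))" using mj by (intro pa_R_mono[OF w]) linarith+
    then show False using V[OF that(1-3)] that(3,4) by (simp add: pa_interval_def)
  qed
  have up: "k \<le> m * j" if "k \<in> {1..m * n}" "?V (?R k) = j" for k
  proof (rule ccontr)
    assume "\<not> k \<le> m * j"
    then have "?R (m * j) < ?R k" using that by (intro pa_R_strict_mono[OF w]) auto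
    then show False using V[OF that(1) R[OF that(1)] order_refl] that(2) by (simp add: pa_interval_def)
  qed
  have "{k \<in> {1..m * n}. ?V (?R k) = j} \<subseteq> ?A"
  proof
    fix k assume "k \<in> {k \<in> {1..m * n}. ?V (?R k) = j}"
    then have k: "k \<in> {1..m * n}" "?V (?R k) = j" by auto
    from low[OF k(1) R[OF k(1)] order_refl k(2)] up[OF k] show "k \<in> ?A" by simp
  qed
  then have "card {k \<in> {1..m * n}. ?V (?R k) = j} \<le> card ?A"
    by (intro card_mono) auto
  also have A: "card ?A = m" using j by (cases j) auto
  finally have 1: "card {k \<in> {1..m * n}. ?V (?R k) = j} \<le> m" .
  have "{k \<in> {1..m * n}. ?V (l k) = j} \<subseteq> ?A \<union> {k \<in> {m * j + 1..m * n}. l k \<in> pa_interval m n w j}"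
  proof
    fix k assume "k \<in> {k \<in> {1..m * n}. ?V (l k) = j}"
    then have k: "k \<in> {1..m * n}" "?V (l k) = j" by auto
    then have lk: "0 < l k" "l k \<le> ?R k" using l by auto
    from low[OF k(1) lk k(2)] V[OF k(1) lk] k
    show "k \<in> ?A \<union> {k \<in> {m * j + 1..m * n}. l k \<in> pa_interval m n w j}" by auto
  qed
  then have "card {k \<in> {1..m * n}. ?V (l k) = j}
      \<le> card (?A \<union> {k \<in> {m * j + 1..m * n}. l k \<in> pa_interval m n w j})"
    by (intro card_mono) auto
  also have "\<dots> \<le> m + card {k \<in> {m * j + 1..m * n}. l k \<in> pa_interval m n w j}"
    using card_Un_le[of ?A] unfolding A .
  finally show ?thesis
    using 1 by (simp add: mg_degree_pa_graph sum.distrib Int_def)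
qed

section \<open>The conditional mean of the in-degree\<close>

lemma sum_inverse_sqrt_le:
  assumes "a \<le> b"
  shows "(\<Sum>k=a+1..b. 1 / sqrt (real k)) \<le> 2 * (sqrt (real b) - sqrt (real a))"
  using assms
proof (induction b rule: dec_induct)
  case (step b)
  \<comment> \<open>The arithmetic-geometric mean inequality bounds each summand by a telescoping
    difference of square roots, in place of a comparison with an integral.\<close>
  have "sqrt (real b) * sqrt (real (Suc b)) \<le> (real b + real (Suc b)) / 2"
    using arith_geo_mean_sqrt[of "real b" "real (Suc b)"] by (simp add: real_sqrt_mult)
  then have "1 / sqrt (real (Suc b)) \<le> 2 * (sqrt (real (Suc b)) - sqrt (real b))"
    by (simp add: field_simps)
  then show ?case using step by simp
qed simp

text \<open>One factor 1 - \<epsilon> in the denominator comes from the lower bounds on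
  \<open>W\<close>, the other from replacing j - 1 by j. The sum of 1/sqrt(k) is at most 2 sqrt(m)
  (sqrt(n) - sqrt(j)), and sqrt(m) cancels.\<close>

lemma pa_expected_indegree_le:
  fixes \<epsilon> L :: real
  assumes \<epsilon>: "0 < \<epsilon>" "\<epsilon> < 1" and m: "1 \<le> m" and j: "2 \<le> j" "1 \<le> \<epsilon> * real j" "j \<le> n" and L: "0 \<le> L"
    and \<Delta>: "0 \<le> \<Delta>" "\<Delta> \<le> (1 + \<epsilon>) * L"
    and W: "\<And>k. k \<in> {m * (j - 1)..m * n} \<Longrightarrow> (1 - \<epsilon>) * real k \<le> W k"
  shows "(\<Sum>k\<in>{m * j + 1..m * n}. \<Delta> / (2 * sqrt (W k * W (m * (j - 1)))))
           \<le> (1 + \<epsilon>) / (1 - \<epsilon>)^2 * (sqrt (real n / real j) - 1) * L"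
proof -
  let ?i = "m * (j - 1)"
  have i: "0 < ?i" "?i \<le> m * j" "m * j \<le> m * n" using m j by auto
  \<comment> \<open>The condition \<open>1 \<le> \<epsilon> * real j\<close> gives j - 1 at least (1
    - \<epsilon>) j; weakening to the square lets the root be taken exactly.\<close>
  have "(1 - \<epsilon>)^2 * real j \<le> (1 - \<epsilon>) * real j"
    using \<epsilon> by (simp add: power2_eq_square mult_right_mono)
  also have "\<dots> \<le> real (j - 1)" using j by (simp add: algebra_simps of_nat_diff)
  finally have "sqrt ((1 - \<epsilon>)^2 * real j) \<le> sqrt (real (j - 1))" by simp
  then have sj: "(1 - \<epsilon>) * sqrt (real j) \<le> sqrt (real (j - 1))"
    using \<epsilon> by (simp add: real_sqrt_mult)
  have summand: "\<Delta> / (2 * sqrt (W k * W ?i))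
      \<le> (1 + \<epsilon>) * L / (2 * (1 - \<epsilon>)^2 * sqrt (real m) * sqrt (real j)) * (1 / sqrt (real k))"
    if k: "k \<in> {m * j + 1..m * n}" for k
  proof -
    have "((1 - \<epsilon>) * real k) * ((1 - \<epsilon>) * real ?i) \<le> W k * W ?i"
    proof -
      have "k \<in> {?i..m * n}" "?i \<in> {?i..m * n}"
        using k i unfolding atLeastAtMost_iff by linarith+
      from this[THEN W] show ?thesis
        using \<epsilon> by (intro mult_mono) (auto intro: order_trans[rotated])
    qed
    then have "sqrt (((1 - \<epsilon>) * real k) * ((1 - \<epsilon>) * real ?i)) \<le> sqrt (W k * W ?i)" by simp
    also have "sqrt (((1 - \<epsilon>) * real k) * ((1 - \<epsilon>) * real ?i))
        = (1 - \<epsilon>) * sqrt (real k) * (sqrt (real m) * sqrt (real (j - 1)))"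
      using \<epsilon> by (simp add: real_sqrt_mult)
    finally have a: "(1 - \<epsilon>) * sqrt (real k) * (sqrt (real m) * sqrt (real (j - 1))) \<le> sqrt (W k * W ?i)" .
    have "(1 - \<epsilon>) * sqrt (real k) * (sqrt (real m) * ((1 - \<epsilon>) * sqrt (real j)))
        \<le> (1 - \<epsilon>) * sqrt (real k) * (sqrt (real m) * sqrt (real (j - 1)))"
      using \<epsilon> sj by (intro mult_left_mono) auto
    note b = order_trans[OF this a]
    have p: "0 < (1 - \<epsilon>) * sqrt (real k) * (sqrt (real m) * ((1 - \<epsilon>) * sqrt (real j)))"
      using \<epsilon> m j k by simp
    have "\<Delta> / (2 * sqrt (W k * W ?i))
        \<le> (1 + \<epsilon>) * L / (2 * ((1 - \<epsilon>) * sqrt (real k) * (sqrt (real m) * ((1 - \<epsilon>) * sqrt (real j)))))"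
      using b p \<Delta> \<epsilon> L by (intro frac_le) auto
    also have "\<dots> = (1 + \<epsilon>) * L / (2 * (1 - \<epsilon>)^2 * sqrt (real m) * sqrt (real j)) * (1 / sqrt (real k))"
      by (simp add: power2_eq_square ac_simps)
    finally show ?thesis .
  qed
  have "(\<Sum>k\<in>{m * j + 1..m * n}. \<Delta> / (2 * sqrt (W k * W ?i)))
      \<le> (1 + \<epsilon>) * L / (2 * (1 - \<epsilon>)^2 * sqrt (real m) * sqrt (real j)) *
         (\<Sum>k=m * j + 1..m * n. 1 / sqrt (real k))"
    unfolding sum_distrib_left by (intro sum_mono summand)
  also have "\<dots> \<le> (1 + \<epsilon>) * L / (2 * (1 - \<epsilon>)^2 * sqrt (real m) * sqrt (real j)) *
         (2 * (sqrt (real (m * n)) - sqrt (real (m * j))))"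
    using L \<epsilon> by (intro mult_left_mono sum_inverse_sqrt_le i) auto
  also have "\<dots> = (1 + \<epsilon>) / (1 - \<epsilon>)^2 * (sqrt (real n / real j) - 1) * L"
    using m j \<epsilon> by (simp add: real_sqrt_mult real_sqrt_divide field_simps)
  finally show ?thesis .
qed

section \<open>The conditional tail of a single degree\<close>

lemma AE_pa_l_law:
  assumes "\<forall>i\<in>{1..m * n + 1}. 0 < w i"
  shows "AE l in pa_l_law m n w. \<forall>k\<in>{1..m * n}. 0 < l k \<and> l k \<le> pa_R m n w k"
  unfolding pa_l_law_def
proof (intro eventually_ball_finite ballI)
  fix k assume k: "k \<in> {1..m * n}"
  have "AE x in density lborel (pa_end_density (pa_R m n w k)). 0 < x \<and> x \<le> pa_R m n w k"
    by (subst AE_density) (auto simp: pa_end_density_def)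
  then show "AE l in \<Pi>\<^sub>M k\<in>{1..m * n}. density lborel (pa_end_density (pa_R m n w k)).
      0 < l k \<and> l k \<le> pa_R m n w k"
    using k by (intro AE_PiM_component prob_space_pa_end_density pa_R_pos[OF assms]) auto
qed simp

text \<open>Base-\<open>z\<close> Chernoff bound for the later hits, with mean at most \<eta> s L
  where s = sqrt(n/j) - 1. The up to 2m block endpoints cost the factor \<open>z ^ (2 * m)\<close>.
  As \<epsilon> tends to 0, \<eta> tends to 1 and the exponent to -s L (z ln z + 1 - z).\<close>

lemma pa_degree_tail:
  fixes \<epsilon> L z :: real
  defines "\<eta> \<equiv> (1 + \<epsilon>) / (1 - \<epsilon>)^2"
  assumes w: "\<forall>i\<in>{1..m * n + 1}. 0 < w i"
    and \<epsilon>: "0 < \<epsilon>" "\<epsilon> < 1" and m: "1 \<le> m" and j: "2 \<le> j" "1 \<le> \<epsilon> * real j" "j \<le> n" and L: "0 \<le> L"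
    and \<Delta>: "pa_W w (m * j) - pa_W w (m * (j - 1)) \<le> (1 + \<epsilon>) * L"
    and W: "\<And>k. k \<in> {m * (j - 1)..m * n} \<Longrightarrow> (1 - \<epsilon>) * real k \<le> pa_W w k"
    and z: "1 < z"
  shows "emeasure (pa_l_law m n w) {l \<in> space (pa_l_law m n w).
            z * (sqrt (real n / real j) - 1) * L < real (mg_degree (pa_graph m n w l) j)}
          \<le> ennreal (z ^ (2 * m) * exp (- ((sqrt (real n / real j) - 1) * (z * ln z - \<eta> * (z - 1)) * L)))"
proof -
  let ?s = "sqrt (real n / real j) - 1" and ?i = "m * (j - 1)" and ?I = "pa_interval m n w j"
  let ?D = "pa_W w (m * j) - pa_W w ?i" and ?K = "{m * j + 1..m * n}" and ?N = "m * n + 1"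
  let ?T = "z * ?s * L - 2 * real m"
  have i: "0 < ?i" "?i < m * j" "m * j \<le> m * n" using m j by auto
  have pos: "0 < pa_W w ?N" "0 < pa_W w ?i" "0 < ?D"
    using i pa_W_pos[OF w, of ?N] pa_W_pos[OF w, of ?i] pa_W_strict_mono[OF w, of ?i "m * j"] by linarith+
  have "emeasure (pa_l_law m n w) {l \<in> space (pa_l_law m n w).
            z * ?s * L < real (mg_degree (pa_graph m n w l) j)}
      \<le> emeasure (pa_l_law m n w) {l \<in> space (pa_l_law m n w). ?T \<le> real (card {k\<in>?K. l k \<in> ?I})}"
  \<comment> \<open>The degree bound uses that each \<open>l k\<close> lies in its support, which
    holds only almost surely.\<close>
  proof (rule emeasure_mono_AE)
    show "AE l in pa_l_law m n w.
        l \<in> {l \<in> space (pa_l_law m n w). z * ?s * L < real (mg_degree (pa_graph m n w l) j)} \<longrightarrow>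
        l \<in> {l \<in> space (pa_l_law m n w). ?T \<le> real (card {k\<in>?K. l k \<in> ?I})}"
      using AE_pa_l_law[OF w]
    proof eventually_elim
      case (elim l)
      have "real (mg_degree (pa_graph m n w l) j) \<le> real (2 * m + card {k\<in>?K. l k \<in> ?I})"
        using mg_degree_pa_graph_le[OF w elim, of j] j by (intro of_nat_mono) auto
      then show ?case by auto
    qed
    have [measurable]: "(\<lambda>l. l k) \<in> borel_measurable (pa_l_law m n w)" if "k \<in> ?K" for k
      using that unfolding pa_l_law_def by (intro measurable_PiM_component_rev) auto
    \<comment> \<open>As a sum of indicators of coordinates the count is visibly measurable.\<close>
    have eq: "real (card {k\<in>?K. l k \<in> ?I}) = (\<Sum>k\<in>?K. indicator ?I (l k))" for l
      by (simp add: indicator_def sum.If_cases Int_def)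
    have [measurable]: "?I \<in> sets borel" by (simp add: pa_interval_def)
    show "{l \<in> space (pa_l_law m n w). ?T \<le> real (card {k\<in>?K. l k \<in> ?I})} \<in> sets (pa_l_law m n w)"
      unfolding eq by measurable
  qed
  also have "\<dots> \<le> ennreal (exp ((z - 1) * (\<Sum>k\<in>?K. ?D / (2 * sqrt (pa_W w k * pa_W w ?i))) - ?T * ln z))"
  proof (rule pa_l_law_Chernoff[OF w _ z])
    fix k assume k: "k \<in> ?K"
    have Wk: "0 < pa_W w k" using k pa_W_pos[OF w, of k] by auto
    show "0 \<le> ?D / (2 * sqrt (pa_W w k * pa_W w ?i))" using pos Wk by simp
    have "emeasure (density lborel (pa_end_density (pa_R m n w k))) ?I
        \<le> ennreal ((pa_R m n w (m * j) - pa_R m n w ?i) / (2 * sqrt (pa_R m n w k * pa_R m n w ?i)))"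
    proof -
      have "?i \<le> ?N" "m * j \<le> ?N" "?i \<le> m * j" "0 < k" "k \<le> ?N"
        using i k unfolding atLeastAtMost_iff by linarith+
      then show ?thesis
        unfolding pa_interval_def using i(1)
        by (intro emeasure_pa_end_density_Ioc pa_R_pos[OF w] pa_R_mono[OF w])
    qed
    also have "(pa_R m n w (m * j) - pa_R m n w ?i) / (2 * sqrt (pa_R m n w k * pa_R m n w ?i))
        = ?D / (2 * sqrt (pa_W w k * pa_W w ?i))"
      using pos Wk
      by (simp add: pa_R_def real_sqrt_divide real_sqrt_mult field_simps)
    finally show "emeasure (density lborel (pa_end_density (pa_R m n w k))) ?I
        \<le> ennreal (?D / (2 * sqrt (pa_W w k * pa_W w ?i)))" .
  qed (auto simp: pa_interval_def)
  also have "\<dots> \<le> ennreal (exp ((z - 1) * (\<eta> * ?s * L) - ?T * ln z))"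
    unfolding \<eta>_def using z pos \<Delta> W
    by (intro ennreal_leI iffD2[OF exp_le_cancel_iff] diff_right_mono mult_left_mono
        pa_expected_indegree_le \<epsilon> m j L) auto
  also have "(z - 1) * (\<eta> * ?s * L) - ?T * ln z
      = real (2 * m) * ln z + (- (?s * (z * ln z - \<eta> * (z - 1)) * L))"
    by (simp add: algebra_simps)
  also have "exp \<dots> = z ^ (2 * m) * exp (- (?s * (z * ln z - \<eta> * (z - 1)) * L))"
    unfolding exp_add exp_of_nat_mult using z by simp
  finally show ?thesis .
qed

section \<open>Concentration of the gaps\<close>

text \<open>Positivity, an almost sure property, is built in so that the conditional estimates hold
  at every point of the set. The lower bound starts at \<open>k0\<close> because relative deviations
  of \<open>pa_W w k\<close> are unlikely only for large \<open>k\<close>.\<close>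

definition pa_w_good :: "nat \<Rightarrow> nat \<Rightarrow> real \<Rightarrow> nat \<Rightarrow> (nat \<Rightarrow> real) set" where
  "pa_w_good m n \<epsilon> k0 = {w \<in> space (pa_w_law m n). (\<forall>i\<in>{1..m * n + 1}. 0 < w i) \<and>
     (\<forall>k\<in>{k0..m * n}. (1 - \<epsilon>) * real k \<le> pa_W w k) \<and>
     (\<forall>j\<in>{1..n}. pa_W w (m * j) - pa_W w (m * (j - 1)) \<le> (1 + \<epsilon>) * ln (real n))}"

lemma pa_w_law_measurable_W [measurable]:
  "k \<le> m * n + 1 \<Longrightarrow> (\<lambda>w. pa_W w k) \<in> borel_measurable (pa_w_law m n)"
  using pa_W_measurable[of k m n] by (simp cong: measurable_cong_sets)

lemma pa_w_law_measurable_component [measurable]: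
  "i \<in> {1..m * n + 1} \<Longrightarrow> (\<lambda>w. w i) \<in> borel_measurable (pa_w_law m n)"
  using measurable_component_singleton[of i "{1..m * n + 1}" "\<lambda>_. borel"]
  by (simp cong: measurable_cong_sets)

lemma sets_pa_w_good: "pa_w_good m n \<epsilon> k0 \<in> sets (pa_w_law m n)"
proof -
  have 1: "m * j \<le> m * n + 1" "m * (j - 1) \<le> m * n + 1" if "j \<in> {1..n}" for j
    using that by (auto intro!: mult_le_mono2 le_SucI)
  have "{w \<in> space (pa_w_law m n). \<forall>i\<in>{1..m * n + 1}. 0 < w i} \<in> sets (pa_w_law m n)"
    "{w \<in> space (pa_w_law m n). \<forall>k\<in>{k0..m * n}. (1 - \<epsilon>) * real k \<le> pa_W w k} \<in> sets (pa_w_law m n)"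
    "{w \<in> space (pa_w_law m n). \<forall>j\<in>{1..n}.
        pa_W w (m * j) - pa_W w (m * (j - 1)) \<le> (1 + \<epsilon>) * ln (real n)} \<in> sets (pa_w_law m n)"
    using 1 by (auto intro!: sets.sets_Collect_finite_All borel_measurable_less borel_measurable_le
        borel_measurable_diff pa_w_law_measurable_W pa_w_law_measurable_component
        simp del: sets_pa_w_law One_nat_def)
  from sets.Int[OF this(1) sets.Int[OF this(2,3)]] show ?thesis
    by (rule back_subst[where P = "\<lambda>A. A \<in> sets (pa_w_law m n)"]) (auto simp: pa_w_good_def)
qed

text \<open>Union bound over two families of Chernoff estimates:
  \<open>t = - (\<epsilon> / 2)\<close> for the lower tails of \<open>pa_W w k\<close>, and
  \<open>t = \<theta>\<close> for the upper tails of the \<open>n\<close> block sums. The free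
  \<open>\<theta>\<close> is later chosen with \<theta> (1 + \<epsilon>) > 1.\<close>

lemma emeasure_pa_w_bad:
  fixes \<epsilon> \<theta> :: real
  assumes \<epsilon>: "0 < \<epsilon>" and \<theta>: "0 < \<theta>" "\<theta> < 1" and n: "1 \<le> n"
  shows "emeasure (pa_w_law m n) (space (pa_w_law m n) - pa_w_good m n \<epsilon> k0)
           \<le> ennreal ((\<Sum>k\<in>{k0..m * n}. (exp (\<epsilon> / 2 * (1 - \<epsilon>)) / (1 + \<epsilon> / 2)) ^ k)
               + (1 / (1 - \<theta>)) ^ m * real n powr (1 - \<theta> * (1 + \<epsilon>)))"
proof -
  let ?P = "pa_w_law m n" and ?q = "exp (\<epsilon> / 2 * (1 - \<epsilon>)) / (1 + \<epsilon> / 2)"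
  let ?L = "ln (real n)"
  \<comment> \<open>The negative factor reverses the inequality, so this is a lower-tail event in
    the form of \<open>pa_w_law_Chernoff\<close>.\<close>
  define A where "A k = {w \<in> space ?P. - (\<epsilon> / 2) * ((1 - \<epsilon>) * real k) \<le> - (\<epsilon> / 2) * (\<Sum>i\<in>{1..k}. w i)}" for k
  define B where
    "B j = {w \<in> space ?P. \<theta> * ((1 + \<epsilon>) * ?L) \<le> \<theta> * (\<Sum>i\<in>{m * (j - 1) + 1..m * j}. w i)}" for j
  have sub: "{m * (j - 1) + 1..m * j} \<subseteq> {1..m * n + 1}" if "j \<in> {1..n}" for j
  proof -
    have "m * j \<le> m * n" using that by simp
    then show ?thesis unfolding atLeastatMost_subset_iff by linarith
  qed
  have A [measurable]: "A k \<in> sets ?P" if "k \<in> {k0..m * n}" for k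
    unfolding A_def using that
    by (intro borel_measurable_le borel_measurable_times borel_measurable_sum
        pa_w_law_measurable_component) auto
  have B [measurable]: "B j \<in> sets ?P" if "j \<in> {1..n}" for j
    unfolding B_def using sub[OF that]
    by (intro borel_measurable_le borel_measurable_times borel_measurable_sum
        pa_w_law_measurable_component) auto
  have W: "(\<Sum>i\<in>{m * (j - 1) + 1..m * j}. w i) = pa_W w (m * j) - pa_W w (m * (j - 1))" for j w
    by (rule pa_W_diff[symmetric]) simp
  have UA: "(\<Union>k\<in>{k0..m * n}. A k) \<in> sets ?P" and UB: "(\<Union>j\<in>{1..n}. B j) \<in> sets ?P"
    using A B by (auto intro!: sets.finite_UN simp del: sets_pa_w_law)
  have "emeasure ?P (space ?P - pa_w_good m n \<epsilon> k0)
      \<le> emeasure ?P ((\<Union>k\<in>{k0..m * n}. A k) \<union> (\<Union>j\<in>{1..n}. B j))"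
  \<comment> \<open>Failure of positivity also makes \<open>w\<close> bad, but only on a null
    set.\<close>
  proof (rule emeasure_mono_AE)
    show "AE w in ?P. w \<in> space ?P - pa_w_good m n \<epsilon> k0 \<longrightarrow>
        w \<in> (\<Union>k\<in>{k0..m * n}. A k) \<union> (\<Union>j\<in>{1..n}. B j)"
      using AE_pa_w_law_pos
    proof eventually_elim
      case (elim w)
      show ?case
      proof
        assume w: "w \<in> space ?P - pa_w_good m n \<epsilon> k0"
        then consider k where "k \<in> {k0..m * n}" "pa_W w k < (1 - \<epsilon>) * real k"
          | j where "j \<in> {1..n}" "(1 + \<epsilon>) * ?L < pa_W w (m * j) - pa_W w (m * (j - 1))"
          using elim by (auto simp: pa_w_good_def not_le simp del: One_nat_def)
        then show "w \<in> (\<Union>k\<in>{k0..m * n}. A k) \<union> (\<Union>j\<in>{1..n}. B j)"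
        proof cases
          case (1 k)
          then have "w \<in> A k" using w \<epsilon> by (auto simp: A_def pa_W_def)
          then show ?thesis using 1 by blast
        next
          case (2 j)
          then have "w \<in> B j" using w \<theta> unfolding B_def W by auto
          then show ?thesis using 2 by blast
        qed
      qed
    qed
  qed (use UA UB in \<open>auto simp del: sets_pa_w_law\<close>)
  also have "\<dots> \<le> emeasure ?P (\<Union>k\<in>{k0..m * n}. A k) + emeasure ?P (\<Union>j\<in>{1..n}. B j)"
    by (rule emeasure_subadditive[OF UA UB])
  also have "\<dots> \<le> (\<Sum>k\<in>{k0..m * n}. emeasure ?P (A k)) + (\<Sum>j\<in>{1..n}. emeasure ?P (B j))"
    using A B by (intro add_mono emeasure_subadditive_finite) (auto simp del: sets_pa_w_law)
  also have "\<dots> \<le> (\<Sum>k\<in>{k0..m * n}. ennreal (?q ^ k))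
      + (\<Sum>j\<in>{1..n}. ennreal ((1 / (1 - \<theta>)) ^ m * real n powr (- \<theta> * (1 + \<epsilon>))))"
  proof (intro add_mono sum_mono)
    fix k assume "k \<in> {k0..m * n}"
    then have "emeasure ?P (A k)
        \<le> ennreal (exp (- (- (\<epsilon> / 2)) * ((1 - \<epsilon>) * real k)) * (1 / (1 - (- (\<epsilon> / 2)))) ^ card {1..k})"
      unfolding A_def using \<epsilon> by (intro pa_w_law_Chernoff) auto
    also have "exp (- (- (\<epsilon> / 2)) * ((1 - \<epsilon>) * real k)) * (1 / (1 - (- (\<epsilon> / 2)))) ^ card {1..k} = ?q ^ k"
      by (simp add: power_divide mult_ac flip: exp_of_nat_mult)
    finally show "emeasure ?P (A k) \<le> ennreal (?q ^ k)" .
  next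
    fix j assume j: "j \<in> {1..n}"
    have "card {m * (j - 1) + 1..m * j} = m" using j by (cases j) auto
    then have "emeasure ?P (B j) \<le> ennreal (exp (- \<theta> * ((1 + \<epsilon>) * ?L)) * (1 / (1 - \<theta>)) ^ m)"
      unfolding B_def using pa_w_law_Chernoff[OF sub[OF j] \<theta>(2), of "(1 + \<epsilon>) * ?L"] by simp
    also have "exp (- \<theta> * ((1 + \<epsilon>) * ?L)) * (1 / (1 - \<theta>)) ^ m
        = (1 / (1 - \<theta>)) ^ m * real n powr (- \<theta> * (1 + \<epsilon>))"
      using n by (simp add: powr_def mult_ac)
    finally show "emeasure ?P (B j) \<le> ennreal ((1 / (1 - \<theta>)) ^ m * real n powr (- \<theta> * (1 + \<epsilon>)))" .
  qed
  also have "\<dots> = ennreal ((\<Sum>k\<in>{k0..m * n}. ?q ^ k)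
      + real n * ((1 / (1 - \<theta>)) ^ m * real n powr (- \<theta> * (1 + \<epsilon>))))"
    using \<epsilon> \<theta> by (subst ennreal_plus)
      (auto intro!: sum_nonneg simp: sum_ennreal ennreal_mult ennreal_of_nat_eq_real_of_nat)
  also have "real n * ((1 / (1 - \<theta>)) ^ m * real n powr (- \<theta> * (1 + \<epsilon>)))
      = (1 / (1 - \<theta>)) ^ m * real n powr (1 - \<theta> * (1 + \<epsilon>))"
    using powr_mult_base[of "real n" "- \<theta> * (1 + \<epsilon>)"] by simp
  finally show ?thesis .
qed

section \<open>Geometric decay of the lower-tail bounds\<close>

lemma sum_power_le_tail:
  fixes q :: real
  assumes "0 \<le> q" "q < 1"
  shows "(\<Sum>k\<in>{a..b}. q ^ k) \<le> q ^ a / (1 - q)"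
  using assms by (auto simp: sum_gp intro!: divide_right_mono)

text \<open>With x = \<epsilon>/2 this follows from x (1 - 2x) < x - x^2, which is at most ln(1 +
  x).\<close>

lemma pa_chernoff_base_less_1:
  fixes \<epsilon> :: real
  assumes "0 < \<epsilon>" "\<epsilon> < 1"
  shows "exp (\<epsilon> / 2 * (1 - \<epsilon>)) / (1 + \<epsilon> / 2) < 1"
proof -
  have "\<epsilon> / 2 * (1 - \<epsilon>) < \<epsilon> / 2 * (1 - \<epsilon> / 2)"
    using assms by (intro mult_strict_left_mono) auto
  also have "\<dots> \<le> ln (1 + \<epsilon> / 2)"
    using ln_one_plus_pos_lower_bound[of "\<epsilon> / 2"] assms by (simp add: power2_eq_square right_diff_distrib)
  finally have "exp (\<epsilon> / 2 * (1 - \<epsilon>)) < exp (ln (1 + \<epsilon> / 2))"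
    by (rule iffD2[OF exp_less_cancel_iff])
  then show ?thesis using assms by simp
qed

section \<open>Degrees with high probability\<close>

text \<open>The three terms bound the failure of the lower bounds on \<open>pa_W\<close>, the
  failure of the block bounds, and a union over at most \<open>n\<close> vertices of conditional
  degree tails. The last decays exactly when s f > 1.\<close>

lemma measure_pa_degree_exceeds_le:
  fixes \<epsilon> \<theta> \<sigma> z :: real and m n j0 :: nat
  defines "q \<equiv> exp (\<epsilon> / 2 * (1 - \<epsilon>)) / (1 + \<epsilon> / 2)"
    and "f \<equiv> z * ln z - (1 + \<epsilon>) / (1 - \<epsilon>)^2 * (z - 1)"
    and "s \<equiv> (1 - \<sigma>) powr (-1/2) - 1"
  assumes m: "1 \<le> m" and n: "1 \<le> n" and \<epsilon>: "0 < \<epsilon>" "\<epsilon> < 1" and \<theta>: "0 < \<theta>" "\<theta> < 1"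
    and \<sigma>: "0 < \<sigma>" "\<sigma> < 1" and z: "1 < z" and f: "0 \<le> f" and j0: "2 \<le> j0" "1 \<le> \<epsilon> * real j0"
  shows "measure (pa_space m n) {\<omega> \<in> space (pa_space m n). \<exists>j. j0 \<le> j \<and> real j \<le> (1 - \<sigma>) * real n \<and>
            z * (sqrt (real n / real j) - 1) * ln (real n) < real (mg_degree (pa_graph m n (fst \<omega>) (snd \<omega>)) j)}
          \<le> q ^ (m * (j0 - 1)) / (1 - q) + (1 / (1 - \<theta>)) ^ m * real n powr (1 - \<theta> * (1 + \<epsilon>))
             + z ^ (2 * m) * real n powr (1 - s * f)"
proof -
  let ?P = "pa_space m n" and ?L = "ln (real n)" and ?k0 = "m * (j0 - 1)"
  define J where "J = {j. j0 \<le> j \<and> real j \<le> (1 - \<sigma>) * real n}"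
  have Jn: "j \<le> n" if "j \<in> J" for j
  proof -
    have "real j \<le> (1 - \<sigma>) * real n" using that by (simp add: J_def)
    also have "\<dots> \<le> 1 * real n" using \<sigma> by (intro mult_right_mono) auto
    finally show ?thesis by simp
  qed
  then have J: "J \<subseteq> {1..n}" using j0 by (auto simp: J_def)
  then have finJ: "finite J" and cardJ: "card J \<le> n"
    using finite_subset[OF J] card_mono[OF _ J] by auto
  define bad where "bad j = {\<omega> \<in> space ?P. z * (sqrt (real n / real j) - 1) * ?L
      < real (mg_degree (pa_graph m n (fst \<omega>) (snd \<omega>)) j)}" for j
  have bad: "bad j \<in> sets ?P" for j
    unfolding bad_def by measurable
  define B where "B = (\<Union>j\<in>J. bad j)"
  have B: "B \<in> sets ?P" unfolding B_def using bad finJ by (intro sets.finite_UN) auto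
  have eqB: "{\<omega> \<in> space ?P. \<exists>j. j0 \<le> j \<and> real j \<le> (1 - \<sigma>) * real n \<and>
      z * (sqrt (real n / real j) - 1) * ?L < real (mg_degree (pa_graph m n (fst \<omega>) (snd \<omega>)) j)} = B"
    by (auto simp: B_def bad_def J_def)
  have L: "0 \<le> ?L" using n by simp
  \<comment> \<open>The factor sqrt(n/j) - 1 decreases in j, so the cutoff (1 - \<sigma>) n is the
    worst case and produces the level in the root equation.\<close>
  have s_le: "s \<le> sqrt (real n / real j) - 1" if "j \<in> J" for j
  proof -
    have "0 < real j" "real j \<le> (1 - \<sigma>) * real n" using that j0 by (auto simp: J_def)
    then have "1 / (1 - \<sigma>) \<le> real n / real j" using \<sigma> by (simp add: field_simps)
    then have "sqrt (1 / (1 - \<sigma>)) \<le> sqrt (real n / real j)" by simp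
    moreover have "(1 - \<sigma>) powr (-1/2) = sqrt (1 / (1 - \<sigma>))"
      using powr_minus[of "1 - \<sigma>" "1/2"] powr_half_sqrt[of "1 - \<sigma>"] \<sigma>
      by (simp add: real_sqrt_divide inverse_eq_divide)
    ultimately show ?thesis by (simp add: s_def)
  qed
  define c where "c = z ^ (2 * m) * real n powr (1 - s * f)"
  have cond: "emeasure (pa_l_law m n w) {l \<in> space (pa_l_law m n w). (w, l) \<in> B} \<le> ennreal c"
    if w: "w \<in> pa_w_good m n \<epsilon> ?k0" for w
  proof -
    let ?M = "pa_l_law m n w"
    have wpos: "\<forall>i\<in>{1..m * n + 1}. 0 < w i" and wsp: "w \<in> space (pa_w_law m n)"
      using w by (auto simp: pa_w_good_def)
    have wsp': "w \<in> space (pa_w_space m n)"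
      using wsp sets_eq_imp_space_eq[OF sets_pa_w_law] by metis
    define E where "E j = {l \<in> space ?M. (w, l) \<in> bad j}" for j
    have Esets: "E j \<in> sets ?M" for j
    proof -
      have [measurable]: "bad j \<in> sets (pa_w_space m n \<Otimes>\<^sub>M pa_l_space m n)" using bad by simp
      show ?thesis unfolding E_def using wsp' by measurable
    qed
    have "emeasure ?M {l \<in> space ?M. (w, l) \<in> B} = emeasure ?M (\<Union>j\<in>J. E j)"
      by (intro arg_cong[where f = "emeasure ?M"]) (auto simp: B_def E_def)
    also have "\<dots> \<le> (\<Sum>j\<in>J. emeasure ?M (E j))"
      using finJ Esets by (intro emeasure_subadditive_finite) auto
    also have "\<dots> \<le> (\<Sum>j\<in>J. ennreal (z ^ (2 * m) * real n powr (- s * f)))"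
    proof (rule sum_mono)
      fix j assume j: "j \<in> J"
      let ?s = "sqrt (real n / real j) - 1"
      have j': "2 \<le> j" "j \<le> n" "j0 \<le> j" using j j0 Jn by (auto simp: J_def)
      have "\<epsilon> * real j0 \<le> \<epsilon> * real j" using j' \<epsilon> by simp
      with j0 have \<epsilon>j: "1 \<le> \<epsilon> * real j" by simp
      \<comment> \<open>The left end of the block of \<open>j0\<close> is the smallest index at
        which any of these vertices needs the lower bound on \<open>pa_W\<close>.\<close>
      have k0: "?k0 \<le> m * (j - 1)" using j' by (intro mult_le_mono2) auto
      have "emeasure ?M (E j) \<le> emeasure ?M {l \<in> space ?M.
          z * ?s * ?L < real (mg_degree (pa_graph m n w l) j)}"
      proof -
        have "E j = {l \<in> space ?M. z * ?s * ?L < real (mg_degree (pa_graph m n w l) j)}"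
          using wsp' sets_eq_imp_space_eq[OF sets_pa_l_law, of m n w] sets_eq_imp_space_eq[OF sets_pa_space, of m n]
          by (auto simp: E_def bad_def space_pair_measure)
        then show ?thesis by simp
      qed
      also have "\<dots> \<le> ennreal (z ^ (2 * m) * exp (- (?s * f * ?L)))"
        unfolding f_def
      proof (rule pa_degree_tail[OF wpos \<epsilon> m j'(1) \<epsilon>j j'(2) L _ _ z])
        show "pa_W w (m * j) - pa_W w (m * (j - 1)) \<le> (1 + \<epsilon>) * ?L"
          using w j' by (auto simp: pa_w_good_def)
        show "(1 - \<epsilon>) * real k \<le> pa_W w k" if "k \<in> {m * (j - 1)..m * n}" for k
        proof -
          have "k \<in> {?k0..m * n}" using that k0 unfolding atLeastAtMost_iff by linarith
          then show ?thesis using w by (simp add: pa_w_good_def)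
        qed
      qed
      \<comment> \<open>Since \<open>f\<close> is nonnegative, passing to the smaller
        \<open>s\<close> gives one bound for all vertices.\<close>
      also have "\<dots> \<le> ennreal (z ^ (2 * m) * exp (- (s * f * ?L)))"
        using z s_le[OF j] f L
        by (intro ennreal_leI mult_left_mono iffD2[OF exp_le_cancel_iff] le_imp_neg_le mult_right_mono) auto
      also have "exp (- (s * f * ?L)) = real n powr (- s * f)"
        using n by (simp add: powr_def)
      finally show "emeasure ?M (E j) \<le> ennreal (z ^ (2 * m) * real n powr (- s * f))" .
    qed
    also have "\<dots> = ennreal (real (card J) * (z ^ (2 * m) * real n powr (- s * f)))"
      using z by (simp add: ennreal_mult ennreal_of_nat_eq_real_of_nat)
    also have "\<dots> \<le> ennreal (real n * (z ^ (2 * m) * real n powr (- s * f)))"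
      using cardJ z by (intro ennreal_leI mult_right_mono) auto
    also have "real n * (z ^ (2 * m) * real n powr (- s * f)) = c"
      using powr_mult_base[of "real n" "- s * f"] by (simp add: c_def)
    finally show ?thesis .
  qed
  have q: "0 \<le> q" "q < 1" using pa_chernoff_base_less_1[OF \<epsilon>] \<epsilon> by (auto simp: q_def)
  let ?b = "(1 / (1 - \<theta>)) ^ m * real n powr (1 - \<theta> * (1 + \<epsilon>))"
  have nonneg: "0 \<le> c" "0 \<le> ?b" "0 \<le> q ^ ?k0 / (1 - q)" using z \<theta> q by (auto simp: c_def)
  have "emeasure ?P B \<le> emeasure (pa_w_law m n) (space (pa_w_law m n) - pa_w_good m n \<epsilon> ?k0) + ennreal c"
    by (rule emeasure_pa_space_le[OF B sets_pa_w_good cond])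
  also have "\<dots> \<le> ennreal ((\<Sum>k\<in>{?k0..m * n}. q ^ k) + ?b) + ennreal c"
    unfolding q_def by (intro add_right_mono emeasure_pa_w_bad \<epsilon> \<theta> n)
  also have "\<dots> \<le> ennreal (q ^ ?k0 / (1 - q) + ?b) + ennreal c"
    by (intro add_right_mono ennreal_leI sum_power_le_tail q)
  also have "\<dots> = ennreal (q ^ ?k0 / (1 - q) + ?b + c)"
    using nonneg by (simp flip: ennreal_plus)
  finally have "measure ?P B \<le> q ^ ?k0 / (1 - q) + ?b + c"
    unfolding measure_def using nonneg by (intro enn2real_leI) auto
  then show ?thesis unfolding eqB c_def .
qed

text \<open>The parameters \<epsilon> and \<theta> are fixed independently of n so that all three
  error terms vanish: the first because the starting vertex tends to infinity, the other two because
  their exponents of n are negative.\<close>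

lemma pa_degree_bound_whp:
  fixes m :: nat and a \<sigma> z :: real
  assumes m: "1 \<le> m" and a: "0 < a" and \<sigma>: "0 < \<sigma>" "\<sigma> < 1" and z: "pa_root \<sigma> < z"
  shows "(\<lambda>n. measure (pa_space m n)
                {(w, l) \<in> space (pa_space m n).
                   \<forall>j. nat \<lfloor>real n powr a\<rfloor> \<le> j \<and> real j \<le> (1 - \<sigma>) * real n \<longrightarrow>
                     real (mg_degree (pa_graph m n w l) j)
                       \<le> z * (sqrt (real n / real j) - 1) * ln (real n)})
         \<longlonglongrightarrow> 1"
proof -
  define s where "s = (1 - \<sigma>) powr (-1/2) - 1"
  define f where "f \<epsilon> = z * ln z - (1 + \<epsilon>) / (1 - \<epsilon>)^2 * (z - 1)" for \<epsilon> :: real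
  define j0 where "j0 n = nat \<lfloor>real n powr a\<rfloor>" for n
  define Bad where "Bad n = {\<omega> \<in> space (pa_space m n). \<exists>j. j0 n \<le> j \<and> real j \<le> (1 - \<sigma>) * real n \<and>
     z * (sqrt (real n / real j) - 1) * ln (real n) < real (mg_degree (pa_graph m n (fst \<omega>) (snd \<omega>)) j)}" for n
  have s: "0 < s" using pa_root_level_pos[OF \<sigma>] by (simp add: s_def)
  have z1: "1 < z" using pa_root_props(1)[OF \<sigma>] z by simp
  have "inverse s < z * ln z + 1 - z"
    using pa_phi_denominator_strict_mono[of "pa_root \<sigma>" z] pa_root_props[OF \<sigma>] z by (simp add: s_def)
  \<comment> \<open>At \<epsilon> = 0 the factor \<open>f\<close> is
    \<open>z * ln z + 1 - z\<close>, so this restates that \<open>z\<close> exceeds the root;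
    continuity then leaves room for a positive \<epsilon>.\<close>
  then have "1 < s * f 0" using s by (simp add: f_def field_simps)
  moreover have "((\<lambda>\<epsilon>. s * f \<epsilon>) \<longlongrightarrow> s * f 0) (at_right 0)"
    unfolding f_def by (intro tendsto_intros) auto
  ultimately have "eventually (\<lambda>\<epsilon>. 1 < s * f \<epsilon>) (at_right 0)"
    by (simp add: order_tendstoD)
  moreover have "eventually (\<lambda>\<epsilon>::real. \<epsilon> \<in> {0<..<1}) (at_right 0)"
    by (rule eventually_at_right_real) simp
  ultimately have "eventually (\<lambda>\<epsilon>. 1 < s * f \<epsilon> \<and> \<epsilon> \<in> {0<..<1}) (at_right 0)"
    by (rule eventually_conj)
  from eventually_happens'[OF trivial_limit_at_right_real this]
  obtain \<epsilon> where \<epsilon>: "0 < \<epsilon>" "\<epsilon> < 1" and sf: "1 < s * f \<epsilon>" by auto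
  \<comment> \<open>Any value strictly between 1/(1 + \<epsilon>) and 1 serves: below 1 the
    exponential moment is finite, and \<theta> (1 + \<epsilon>) > 1 beats the union over n
    blocks.\<close>
  define \<theta> where "\<theta> = 1 / (1 + \<epsilon> / 2)"
  have \<theta>: "0 < \<theta>" "\<theta> < 1" "1 < \<theta> * (1 + \<epsilon>)" using \<epsilon> by (auto simp: \<theta>_def field_simps)
  define q where "q = exp (\<epsilon> / 2 * (1 - \<epsilon>)) / (1 + \<epsilon> / 2)"
  have q: "0 \<le> q" "q < 1" using pa_chernoff_base_less_1[OF \<epsilon>] \<epsilon> by (auto simp: q_def)
  have f0: "0 \<le> f \<epsilon>" using sf s zero_less_mult_pos[of s "f \<epsilon>"] by simp
  have j0: "filterlim j0 at_top at_top"
  proof -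
    have "filterlim (\<lambda>n. \<lfloor>real n powr a\<rfloor>) at_top at_top"
      using a by (intro filterlim_compose[OF filterlim_floor_sequentially]) real_asymp
    then show ?thesis unfolding j0_def by (rule filterlim_compose[OF filterlim_nat_sequentially])
  qed
  have "filterlim (\<lambda>n. m * (j0 n - 1)) at_top at_top"
  proof (rule filterlim_at_top_mono)
    show "filterlim (\<lambda>n. j0 n - 1) at_top at_top"
      by (rule filterlim_compose[OF filterlim_minus_const_nat_at_top j0])
    show "eventually (\<lambda>n. j0 n - 1 \<le> m * (j0 n - 1)) at_top" using m by simp
  qed
  from filterlim_compose[OF LIMSEQ_power_zero this, of q] q
  have "(\<lambda>n. q ^ (m * (j0 n - 1))) \<longlonglongrightarrow> 0" by simp
  moreover have "(\<lambda>n. real n powr (1 - \<theta> * (1 + \<epsilon>))) \<longlonglongrightarrow> 0" "(\<lambda>n. real n powr (1 - s * f \<epsilon>)) \<longlonglongrightarrow> 0"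
    using \<theta> sf by (auto intro!: tendsto_neg_powr filterlim_real_sequentially)
  ultimately have "(\<lambda>n. q ^ (m * (j0 n - 1)) / (1 - q) + (1 / (1 - \<theta>)) ^ m * real n powr (1 - \<theta> * (1 + \<epsilon>))
      + z ^ (2 * m) * real n powr (1 - s * f \<epsilon>)) \<longlonglongrightarrow> 0 / (1 - q) + (1 / (1 - \<theta>)) ^ m * 0 + z ^ (2 * m) * 0"
    using q by (intro tendsto_intros) auto
  then have lim: "(\<lambda>n. q ^ (m * (j0 n - 1)) / (1 - q) + (1 / (1 - \<theta>)) ^ m * real n powr (1 - \<theta> * (1 + \<epsilon>))
      + z ^ (2 * m) * real n powr (1 - s * f \<epsilon>)) \<longlonglongrightarrow> 0" by simp
  \<comment> \<open>The second condition supplies \<open>1 \<le> \<epsilon> * real (j0 n)\<close>,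
    which allows j - 1 to be compared with j.\<close>
  have "eventually (\<lambda>n. 2 \<le> j0 n) at_top" "eventually (\<lambda>n. nat \<lceil>1 / \<epsilon>\<rceil> \<le> j0 n) at_top"
    using j0 unfolding filterlim_at_top by blast+
  moreover have "eventually (\<lambda>n::nat. 1 \<le> n) at_top" by (rule eventually_ge_at_top)
  ultimately have le: "eventually (\<lambda>n. measure (pa_space m n) (Bad n)
      \<le> q ^ (m * (j0 n - 1)) / (1 - q) + (1 / (1 - \<theta>)) ^ m * real n powr (1 - \<theta> * (1 + \<epsilon>))
      + z ^ (2 * m) * real n powr (1 - s * f \<epsilon>)) at_top"
  proof eventually_elim
    case (elim n)
    have "1 / \<epsilon> \<le> real (j0 n)" using elim(2) by linarith
    then have "1 \<le> \<epsilon> * real (j0 n)" using \<epsilon> by (simp add: field_simps)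
    then show ?case
      unfolding Bad_def q_def f_def s_def
      using measure_pa_degree_exceeds_le[OF m elim(3) \<epsilon> \<theta>(1,2) \<sigma> z1 f0[unfolded f_def] elim(1)] by simp
  qed
  have "(\<lambda>n. measure (pa_space m n) (Bad n)) \<longlonglongrightarrow> 0"
    by (rule tendsto_sandwich[OF _ le tendsto_const lim]) simp
  then have "(\<lambda>n. 1 - measure (pa_space m n) (Bad n)) \<longlonglongrightarrow> 1 - 0" by (intro tendsto_intros)
  moreover have "1 - measure (pa_space m n) (Bad n) = measure (pa_space m n)
                {(w, l) \<in> space (pa_space m n).
                   \<forall>j. nat \<lfloor>real n powr a\<rfloor> \<le> j \<and> real j \<le> (1 - \<sigma>) * real n \<longrightarrow>
                     real (mg_degree (pa_graph m n w l) j)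
                       \<le> z * (sqrt (real n / real j) - 1) * ln (real n)}" for n
  proof -
    interpret prob_space "pa_space m n" by (rule prob_space_pa_space)
    have "Bad n \<in> sets (pa_space m n)"
      unfolding Bad_def by measurable
    then have "1 - measure (pa_space m n) (Bad n) = measure (pa_space m n) (space (pa_space m n) - Bad n)"
      by (simp add: prob_compl del: sets_pa_space)
    also have "space (pa_space m n) - Bad n = {(w, l) \<in> space (pa_space m n).
                   \<forall>j. nat \<lfloor>real n powr a\<rfloor> \<le> j \<and> real j \<le> (1 - \<sigma>) * real n \<longrightarrow>
                     real (mg_degree (pa_graph m n w l) j)
                       \<le> z * (sqrt (real n / real j) - 1) * ln (real n)}"
      by (auto simp: Bad_def j0_def not_less)
    finally show ?thesis .
  qed
  ultimately show ?thesis by simp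
qed

theorem theorem2p3:
  fixes m :: nat and a :: real
  assumes "m \<ge> 1" and "0 < a" and "a < real m / (real m + 2)"
  shows "(\<forall>\<sigma>\<in>{0<..<1}. \<exists>!z. pa_is_root \<sigma> z)
    \<and> pa_root \<sim>[at_right 0] (\<lambda>\<sigma>. 2 * inverse (\<sigma> * ln (1 / \<sigma>)))
    \<and> (\<forall>\<sigma>\<in>{0<..<1}. \<forall>z. z > pa_root \<sigma> \<longrightarrow>
         (\<lambda>n. measure (pa_space m n)
                {(w, l) \<in> space (pa_space m n).
                   \<forall>j. nat \<lfloor>real n powr a\<rfloor> \<le> j \<and> real j \<le> (1 - \<sigma>) * real n \<longrightarrow>
                     real (mg_degree (pa_graph m n w l) j)
                       \<le> z * (sqrt (real n / real j) - 1) * ln (real n)})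
         \<longlonglongrightarrow> 1)"
  using pa_root_ex1 pa_root_asymp pa_degree_bound_whp[OF assms(1,2)]
  by (intro conjI ballI allI impI) simp_all

end
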